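(* Let $n>3$, let $(x_i)_{i\in\mathbb{Z}_n}$ be a cyclic sequence of points in $\mathbb{R}^d$ with $x_i\ne x_j$ for $i\neq j$, and suppose that its piecewise linear interpolation $\gamma:S^1\to\mathbb{R}^d$ is a topological embedding. Let $\Gamma^a=\{w\in\mathbf{F}_2(S^1):\mathcal{T}_\gamma(w)\le a\}$ and let $\mathcal{V}^a=\{V_{ij}^a\}_{i,j\in\mathbb{Z}_n}$ be the cover of $\Gamma^a$ by the closed sets $V_{ij}^a=V_{ij}\cap\Gamma^a$. Then there is a functorial homotopy equivalence $\Gamma^a\simeq|\mathsf{N}(\mathcal{V}^a)|$ between $\Gamma^a$ and the geometric realisation of the nerve of $\mathcal{V}^a$.
   Context: $\mathbf{F}_2(S^1)$ is the set of non-empty subsets of $S^1$ of cardinality at most $2$, with the quotient topology from $S^1\times S^1$. $\mathcal{T}_\gamma(\{z_1,z_2\})=\tfrac12\|\gamma(z_1)-\gamma(z_2)\|^2$. Piecewise linear interpolation: $u_i=x_{i+1}-x_i$ (indices mod $n$), $l_i=\|u_i\|$, $L=\sum_{i=0}^{n-1} l_i$, $L_i=\sum_{j<i}l_j/L$, and $\gamma(e^{2\pi\mathrm{i}t})=\frac{L}{l_i}(t-L_i)u_i+x_i$ for $t\in[L_i,L_{i+1}]$. For $i,j\in\mathbb{Z}_n$ (unordered pair, possibly $i=j$), $V_{ij}\subset\mathbf{F}_2(S^1)$ is the set of $\{e^{2\pi\mathrm{i}t_1},e^{2\pi\mathrm{i}t_2}\}$ with $t_1\in[L_i,L_{i+1}]$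 and $t_2\in[L_j,L_{j+1}]$. The nerve $\mathsf{N}(\mathcal{V}^a)$ is the simplicial complex whose simplices are the finite sets of indices $\{i,j\}$ for which the corresponding sets $V^a_{ij}$ have non-empty common intersection. For $a\le b$ there are inclusions $\Gamma^a\subseteq\Gamma^b$ and $\mathsf{N}(\mathcal{V}^a)\subseteq\mathsf{N}(\mathcal{V}^b)$; "functorial" means that the homotopy equivalences are compatible with these inclusions (as in the functorial nerve theorem).
   Formalization: The hypothesis n > 3 is replaced by n > 4: for n = 4 and large a, V_02 and V_13 meet in exactly two points, so the nerve has trivial first rational homology while Γ^a is a Möbius band, and the claim fails for every embedded quadrilateral. *)

theory Defs
  imports "HOL-Analysis.Analysis"
begin

section \<open>Non-empty subsets with at most two elements\<close>

definition F2_set :: "'a set \<Rightarrow> 'a set set" where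
  "F2_set S = {w. w \<subseteq> S \<and> finite w \<and> w \<noteq> {} \<and> card w \<le> 2}"

text \<open>The quotient topology along \<open>(z1, z2) \<mapsto> {z1, z2}\<close>; see \<open>quotient_map_F2\<close>.\<close>

definition F2 :: "'a topology \<Rightarrow> 'a set topology" where
  "F2 X = topology (\<lambda>U. U \<subseteq> F2_set (topspace X) \<and>
     openin (prod_topology X X)
       {p \<in> topspace (prod_topology X X). {fst p, snd p} \<in> U})"

lemma F2_set_eq: "F2_set S = (\<lambda>p. {fst p, snd p}) ` (S \<times> S)"
proof
  show "F2_set S \<subseteq> (\<lambda>p. {fst p, snd p}) ` (S \<times> S)"
  proof
    fix w assume w: "w \<in> F2_set S"
    then have "card w = 1 \<or> card w = 2"
      unfolding F2_set_def using card_gt_0_iff[of w] by auto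
    then obtain a b where "w = {a, b}"
      by (metis card_1_singletonE card_2_iff insert_absorb2)
    then show "w \<in> (\<lambda>p. {fst p, snd p}) ` (S \<times> S)"
      using w by (auto simp: F2_set_def image_iff intro!: bexI[of _ "(a, b)"])
  qed
  show "(\<lambda>p. {fst p, snd p}) ` (S \<times> S) \<subseteq> F2_set S"
    by (auto simp: F2_set_def card_insert_if)
qed

lemma openin_F2:
  "openin (F2 X) U \<longleftrightarrow> U \<subseteq> F2_set (topspace X) \<and>
     openin (prod_topology X X)
       {p \<in> topspace (prod_topology X X). {fst p, snd p} \<in> U}"
proof -
  let ?T = "topspace (prod_topology X X)"
  have "istopology (\<lambda>U. U \<subseteq> F2_set (topspace X) \<and>
          openin (prod_topology X X) {p \<in> ?T. {fst p, snd p} \<in> U})"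
    unfolding istopology_def
  proof (intro conjI allI impI)
    fix U V
    assume "U \<subseteq> F2_set (topspace X) \<and> openin (prod_topology X X) {p \<in> ?T. {fst p, snd p} \<in> U}"
      and "V \<subseteq> F2_set (topspace X) \<and> openin (prod_topology X X) {p \<in> ?T. {fst p, snd p} \<in> V}"
    moreover have "{p \<in> ?T. {fst p, snd p} \<in> U \<inter> V}
        = {p \<in> ?T. {fst p, snd p} \<in> U} \<inter> {p \<in> ?T. {fst p, snd p} \<in> V}" by auto
    ultimately show "U \<inter> V \<subseteq> F2_set (topspace X)"
      and "openin (prod_topology X X) {p \<in> ?T. {fst p, snd p} \<in> U \<inter> V}" by auto
  next
    fix \<U>
    assume *: "\<forall>U\<in>\<U>. U \<subseteq> F2_set (topspace X) \<and>
                openin (prod_topology X X) {p \<in> ?T. {fst p, snd p} \<in> U}"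
    then show "\<Union>\<U> \<subseteq> F2_set (topspace X)" by auto
    have "{p \<in> ?T. {fst p, snd p} \<in> \<Union>\<U>} = (\<Union>U\<in>\<U>. {p \<in> ?T. {fst p, snd p} \<in> U})" by auto
    with * show "openin (prod_topology X X) {p \<in> ?T. {fst p, snd p} \<in> \<Union>\<U>}" by auto
  qed
  then show ?thesis unfolding F2_def by (simp add: topology_inverse')
qed

lemma topspace_F2: "topspace (F2 X) = F2_set (topspace X)"
proof (rule antisym)
  show "topspace (F2 X) \<subseteq> F2_set (topspace X)"
    using openin_F2[of X "topspace (F2 X)"] by auto
  have "{p \<in> topspace (prod_topology X X). {fst p, snd p} \<in> F2_set (topspace X)}
      = topspace (prod_topology X X)" by (auto simp: F2_set_eq)
  then have "openin (F2 X) (F2_set (topspace X))"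
    unfolding openin_F2 by (simp only: openin_topspace subset_refl simp_thms)
  then show "F2_set (topspace X) \<subseteq> topspace (F2 X)" by (rule openin_subset)
qed

lemma quotient_map_F2:
  "quotient_map (prod_topology X X) (F2 X) (\<lambda>p. {fst p, snd p})"
  unfolding quotient_map_def topspace_F2
  by (auto simp: F2_set_eq openin_F2)

section \<open>The function on two-point subsets and its sublevel sets\<close>

definition T_fun :: "('a \<Rightarrow> 'b::real_normed_vector) \<Rightarrow> 'a set \<Rightarrow> real" where
  "T_fun \<gamma> w = (THE r. \<exists>z1 z2. w = {z1, z2} \<and> r = (norm (\<gamma> z1 - \<gamma> z2))\<^sup>2 / 2)"

lemma T_fun_eq: "T_fun \<gamma> {z1, z2} = (norm (\<gamma> z1 - \<gamma> z2))\<^sup>2 / 2"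
  unfolding T_fun_def
  by (rule the_equality) (auto simp: doubleton_eq_iff norm_minus_commute)

definition sublevel :: "(complex \<Rightarrow> 'b::real_normed_vector) \<Rightarrow> real \<Rightarrow> complex set set" where
  "sublevel \<gamma> a = {w \<in> F2_set (sphere 0 1). T_fun \<gamma> w \<le> a}"

definition sublevel_space :: "(complex \<Rightarrow> 'b::real_normed_vector) \<Rightarrow> real \<Rightarrow> complex set topology" where
  "sublevel_space \<gamma> a = subtopology (F2 (top_of_set (sphere 0 1))) (sublevel \<gamma> a)"

section \<open>Piecewise linear interpolation\<close>

text \<open>A cyclic sequence \<open>(x\<^sub>i)\<close> with \<open>i \<in> \<int>/n\<close> is given by the values of
  \<open>x :: nat \<Rightarrow> _\<close> on \<open>{..<n}\<close>.\<close>

definition edge_vec :: "nat \<Rightarrow> (nat \<Rightarrow> 'b::real_normed_vector) \<Rightarrow> nat \<Rightarrow> 'b" where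
  "edge_vec n x i = x (Suc i mod n) - x i"

definition edge_len :: "nat \<Rightarrow> (nat \<Rightarrow> 'b::real_normed_vector) \<Rightarrow> nat \<Rightarrow> real" where
  "edge_len n x i = norm (edge_vec n x i)"

definition total_len :: "nat \<Rightarrow> (nat \<Rightarrow> 'b::real_normed_vector) \<Rightarrow> real" where
  "total_len n x = (\<Sum>i<n. edge_len n x i)"

definition knot :: "nat \<Rightarrow> (nat \<Rightarrow> 'b::real_normed_vector) \<Rightarrow> nat \<Rightarrow> real" where
  "knot n x i = (\<Sum>j<i. edge_len n x j / total_len n x)"

definition pl_piece :: "nat \<Rightarrow> (nat \<Rightarrow> 'b::real_normed_vector) \<Rightarrow> nat \<Rightarrow> real \<Rightarrow> 'b" where
  "pl_piece n x i t =
     (total_len n x / edge_len n x i * (t - knot n x i)) *\<^sub>R edge_vec n x i + x i"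

text \<open>The parameter of a point of the circle is taken in \<open>[0, 1)\<close>; the formula for the pieces
  on the closed intervals, including the parameter \<open>1\<close>, is \<open>pl_interp_cis\<close>.
  The value off the unit circle is irrelevant.\<close>

definition pl_interp :: "nat \<Rightarrow> (nat \<Rightarrow> 'b::real_normed_vector) \<Rightarrow> complex \<Rightarrow> 'b" where
  "pl_interp n x z = (let t = Arg2pi z / (2 * pi) in
     pl_piece n x (LEAST i. i < n \<and> t \<in> {knot n x i..knot n x (Suc i)}) t)"

lemma edge_len_pos:
  assumes "n > 1" "inj_on x {..<n}" "i < n"
  shows "edge_len n x i > 0"
proof -
  have "Suc i mod n \<noteq> i"
    using assms by (cases "Suc i = n") auto
  moreover have "Suc i mod n < n" using assms by simp
  ultimately have "x (Suc i mod n) \<noteq> x i"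
    using assms by (metis inj_onD lessThan_iff)
  then show ?thesis by (simp add: edge_len_def edge_vec_def)
qed

lemma total_len_pos:
  assumes "n > 1" "inj_on x {..<n}"
  shows "total_len n x > 0"
  unfolding total_len_def using assms edge_len_pos[OF assms]
  by (intro sum_pos) (auto simp: lessThan_empty_iff)

lemma knot_Suc: "knot n x (Suc i) = knot n x i + edge_len n x i / total_len n x"
  by (simp add: knot_def)

lemma knot_strict_mono:
  assumes "n > 1" "inj_on x {..<n}" "i < j" "j \<le> n"
  shows "knot n x i < knot n x j"
proof -
  have "knot n x j = knot n x i + (\<Sum>k\<in>{i..<j}. edge_len n x k / total_len n x)"
    unfolding knot_def using assms(3)
    by (metis atLeast0LessThan less_imp_le_nat sum.atLeastLessThan_concat zero_le)
  moreover have "(\<Sum>k\<in>{i..<j}. edge_len n x k / total_len n x) > 0"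
    using assms edge_len_pos[OF assms(1,2)] total_len_pos[OF assms(1,2)]
    by (intro sum_pos) auto
  ultimately show ?thesis by simp
qed

lemma knot_n:
  assumes "n > 1" "inj_on x {..<n}"
  shows "knot n x n = 1"
  using total_len_pos[OF assms]
  by (simp add: knot_def sum_divide_distrib[symmetric] total_len_def[symmetric])

lemma pl_piece_knot: "pl_piece n x i (knot n x i) = x i"
  by (simp add: pl_piece_def)

lemma pl_piece_knot_Suc:
  assumes "n > 1" "inj_on x {..<n}" "i < n"
  shows "pl_piece n x i (knot n x (Suc i)) = x (Suc i mod n)"
  using edge_len_pos[OF assms] total_len_pos[OF assms(1,2)]
  by (simp add: pl_piece_def knot_Suc edge_vec_def)

lemma pl_interp_cis:
  assumes n: "n > 1" and x: "inj_on x {..<n}" and i: "i < n"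
    and t: "t \<in> {knot n x i..knot n x (Suc i)}"
  shows "pl_interp n x (cis (2 * pi * t)) = pl_piece n x i t"
proof -
  have k0: "knot n x 0 = 0" by (simp add: knot_def)
  have mono: "knot n x j \<le> knot n x k" if "j \<le> k" "k \<le> n" for j k
    using knot_strict_mono[OF n x, of j k] that by (cases "j = k") auto
  have t0: "0 \<le> t" using mono[of 0 i] i t k0 by auto
  have t1: "t \<le> 1" using mono[of "Suc i" n] i t knot_n[OF n x] by auto
  show ?thesis
  proof (cases "t = 1")
    case True
    have "Suc i = n"
      using knot_strict_mono[OF n x, of "Suc i" n] i t True knot_n[OF n x] by fastforce
    then have "pl_piece n x i t = x 0"
      using pl_piece_knot_Suc[OF n x i] True knot_n[OF n x] by simp
    moreover have "(LEAST i. i < n \<and> (0::real) \<in> {knot n x i..knot n x (Suc i)}) = 0"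
      using n k0 mono[of 0 1] by (intro Least_equality) auto
    then have "pl_interp n x 1 = x 0"
      using pl_piece_knot[of n x 0] k0 by (simp add: pl_interp_def Let_def Arg2pi_of_real[of 1, simplified])
    ultimately show ?thesis using True by simp
  next
    case False
    have "Arg2pi (cis (2 * pi * t)) = 2 * pi * t"
      using t0 t1 False by (intro Arg2pi_unique[of 1]) (auto simp: cis_conv_exp mult_less_cancel_left1)
    then have arg: "Arg2pi (cis (2 * pi * t)) / (2 * pi) = t" by simp
    define j where "j = (LEAST j. j < n \<and> t \<in> {knot n x j..knot n x (Suc j)})"
    have j: "j < n" "t \<in> {knot n x j..knot n x (Suc j)}" "j \<le> i"
      unfolding j_def
      using LeastI[of "\<lambda>j. j < n \<and> t \<in> {knot n x j..knot n x (Suc j)}" i]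
        Least_le[of "\<lambda>j. j < n \<and> t \<in> {knot n x j..knot n x (Suc j)}" i] i t by auto
    have "pl_piece n x j t = pl_piece n x i t"
    proof (cases "j = i")
      case False
      then have "knot n x i = knot n x (Suc j)" "knot n x i = t"
        using j i t mono[of "Suc j" i] by auto
      moreover from this False have "Suc j = i"
        using j i knot_strict_mono[OF n x, of "Suc j" i] by (cases "Suc j = i") auto
      ultimately have "knot n x (Suc j) = t" "knot n x i = t" "Suc j = i" by auto
      then show ?thesis
        using pl_piece_knot_Suc[OF n x j(1)] pl_piece_knot[of n x i] i by auto
    qed simp
    then show ?thesis unfolding pl_interp_def Let_def arg j_def[symmetric] .
  qed
qed

section \<open>The cells\<close>

text \<open>The unordered pair of indices \<open>i, j\<close> is the set \<open>{i, j}\<close>, a singleton if \<open>i = j\<close>.\<close>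

definition cell_index :: "nat \<Rightarrow> nat set set" where
  "cell_index n = {{i, j} | i j. i < n \<and> j < n}"

definition cell :: "nat \<Rightarrow> (nat \<Rightarrow> 'b::real_normed_vector) \<Rightarrow> nat set \<Rightarrow> complex set set" where
  "cell n x e = {{cis (2 * pi * t1), cis (2 * pi * t2)} | t1 t2 i j. e = {i, j} \<and>
     t1 \<in> {knot n x i..knot n x (Suc i)} \<and> t2 \<in> {knot n x j..knot n x (Suc j)}}"

lemma cell_eq:
  "cell n x {i, j} = {{cis (2 * pi * t1), cis (2 * pi * t2)} | t1 t2.
     t1 \<in> {knot n x i..knot n x (Suc i)} \<and> t2 \<in> {knot n x j..knot n x (Suc j)}}"
  (is "_ = ?R")
proof
  show "cell n x {i, j} \<subseteq> ?R"
  proof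
    fix w assume "w \<in> cell n x {i, j}"
    then obtain t1 t2 i' j' where *: "w = {cis (2 * pi * t1), cis (2 * pi * t2)}"
      "{i, j} = {i', j'}" "t1 \<in> {knot n x i'..knot n x (Suc i')}"
      "t2 \<in> {knot n x j'..knot n x (Suc j')}"
      unfolding cell_def by blast
    from *(2) consider "i' = i" "j' = j" | "i' = j" "j' = i"
      by (auto simp: doubleton_eq_iff)
    then show "w \<in> ?R"
    proof cases
      case 1
      then show ?thesis using * by blast
    next
      case 2
      have "w = {cis (2 * pi * t2), cis (2 * pi * t1)}" using *(1) by (simp add: insert_commute)
      then show ?thesis using *(3,4) 2 by blast
    qed
  qed
  show "?R \<subseteq> cell n x {i, j}" unfolding cell_def by blast
qed

definition sublevel_cell ::
    "nat \<Rightarrow> (nat \<Rightarrow> 'b::real_normed_vector) \<Rightarrow> real \<Rightarrow> nat set \<Rightarrow> complex set set" where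
  "sublevel_cell n x a e = cell n x e \<inter> sublevel (pl_interp n x) a"

text \<open>Pitfall: for \<open>n = 4\<close> the cells \<open>{0, 2}\<close> and \<open>{1, 3}\<close> meet in exactly two points, given
  by the two pairs of opposite vertices.  Once \<open>a\<close> is so large that every cell is contained in
  the sublevel set, the nerve has the rational homology of a point although the sublevel set is
  a Moebius band.  From \<open>n = 5\<close> on, all non-empty intersections of cells are convex in the
  parameters \<open>(t1, t2)\<close>.\<close>

section \<open>Nerves and geometric realisations\<close>

definition nerve :: "'i set \<Rightarrow> ('i \<Rightarrow> 'a set) \<Rightarrow> 'i set set" where
  "nerve I V = {\<sigma>. finite \<sigma> \<and> \<sigma> \<noteq> {} \<and> \<sigma> \<subseteq> I \<and> (\<Inter>i\<in>\<sigma>. V i) \<noteq> {}}"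

text \<open>Points of the realisation are barycentric coordinates.  On a single closed simplex the
  product topology of \<open>'v \<Rightarrow> real\<close> is the Euclidean one; the realisation carries the
  topology coherent with its closed simplices.\<close>

definition closed_simplex :: "'v set \<Rightarrow> ('v \<Rightarrow> real) set" where
  "closed_simplex \<sigma> = {\<alpha>. (\<forall>v. 0 \<le> \<alpha> v) \<and> (\<forall>v. v \<notin> \<sigma> \<longrightarrow> \<alpha> v = 0) \<and> sum \<alpha> \<sigma> = 1}"

definition realisation :: "'v set set \<Rightarrow> ('v \<Rightarrow> real) topology" where
  "realisation K = topology (\<lambda>U. U \<subseteq> (\<Union>\<sigma>\<in>K. closed_simplex \<sigma>) \<and>
     (\<forall>\<sigma>\<in>K. openin (top_of_set (closed_simplex \<sigma>)) (U \<inter> closed_simplex \<sigma>)))"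

lemma openin_realisation:
  "openin (realisation K) U \<longleftrightarrow> U \<subseteq> (\<Union>\<sigma>\<in>K. closed_simplex \<sigma>) \<and>
     (\<forall>\<sigma>\<in>K. openin (top_of_set (closed_simplex \<sigma>)) (U \<inter> closed_simplex \<sigma>))"
proof -
  have "istopology (\<lambda>U. U \<subseteq> (\<Union>\<sigma>\<in>K. closed_simplex \<sigma>) \<and>
     (\<forall>\<sigma>\<in>K. openin (top_of_set (closed_simplex \<sigma>)) (U \<inter> closed_simplex \<sigma>)))"
    (is "istopology ?P")
    unfolding istopology_def
  proof (intro conjI[of "\<forall>S T. ?P S \<longrightarrow> ?P T \<longrightarrow> ?P (S \<inter> T)"] allI impI)
    fix S T assume S: "?P S" and T: "?P T"
    have eq: "S \<inter> T \<inter> closed_simplex \<sigma> = (S \<inter> closed_simplex \<sigma>) \<inter> (T \<inter> closed_simplex \<sigma>)" for \<sigma>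
      by auto
    have "openin (top_of_set (closed_simplex \<sigma>)) (S \<inter> T \<inter> closed_simplex \<sigma>)" if "\<sigma> \<in> K" for \<sigma>
      unfolding eq by (rule openin_Int) (use S T that in blast)+
    then show "?P (S \<inter> T)" using S by blast
  next
    fix \<U> assume *: "\<forall>U\<in>\<U>. ?P U"
    have eq: "\<Union>\<U> \<inter> closed_simplex \<sigma> = (\<Union>U\<in>\<U>. U \<inter> closed_simplex \<sigma>)" for \<sigma> by auto
    have "openin (top_of_set (closed_simplex \<sigma>)) (\<Union>\<U> \<inter> closed_simplex \<sigma>)" if "\<sigma> \<in> K" for \<sigma>
      unfolding eq by (rule openin_Union) (use * that in blast)
    then show "?P (\<Union>\<U>)" using * by blast
  qed
  then show ?thesis unfolding realisation_def by (simp add: topology_inverse')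
qed

lemma topspace_realisation: "topspace (realisation K) = (\<Union>\<sigma>\<in>K. closed_simplex \<sigma>)"
proof (rule antisym)
  show "topspace (realisation K) \<subseteq> (\<Union>\<sigma>\<in>K. closed_simplex \<sigma>)"
    using openin_realisation[of K "topspace (realisation K)"] by auto
  have "(\<Union>\<sigma>\<in>K. closed_simplex \<sigma>) \<inter> closed_simplex \<tau> = closed_simplex \<tau>" if "\<tau> \<in> K" for \<tau>
    using that by auto
  then have "openin (realisation K) (\<Union>\<sigma>\<in>K. closed_simplex \<sigma>)"
    unfolding openin_realisation by auto
  then show "(\<Union>\<sigma>\<in>K. closed_simplex \<sigma>) \<subseteq> topspace (realisation K)" by (rule openin_subset)
qed

definition nerve_space ::
    "nat \<Rightarrow> (nat \<Rightarrow> 'b::real_normed_vector) \<Rightarrow> real \<Rightarrow> (nat set \<Rightarrow> real) topology" where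
  "nerve_space n x a = realisation (nerve (cell_index n) (sublevel_cell n x a))"

section \<open>Functorial homotopy equivalences\<close>

definition homotopy_equivalence_map :: "'a topology \<Rightarrow> 'b topology \<Rightarrow> ('a \<Rightarrow> 'b) \<Rightarrow> bool" where
  "homotopy_equivalence_map X Y f \<longleftrightarrow> continuous_map X Y f \<and>
     (\<exists>g. continuous_map Y X g \<and>
          homotopic_with (\<lambda>_. True) X X (g \<circ> f) id \<and>
          homotopic_with (\<lambda>_. True) Y Y (f \<circ> g) id)"

text \<open>For spaces \<open>X a\<close> and \<open>Y a\<close> that increase with \<open>a\<close>: homotopy equivalences
  \<open>f a : X a \<rightarrow> Y a\<close> that commute with the inclusions.\<close>

definition functorial_homotopy_equivalence ::
    "(real \<Rightarrow> 'a topology) \<Rightarrow> (real \<Rightarrow> 'b topology) \<Rightarrow> (real \<Rightarrow> 'a \<Rightarrow> 'b) \<Rightarrow> bool" where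
  "functorial_homotopy_equivalence X Y f \<longleftrightarrow>
     (\<forall>a. homotopy_equivalence_map (X a) (Y a) (f a)) \<and>
     (\<forall>a b. a \<le> b \<longrightarrow> (\<forall>p \<in> topspace (X a). f b p = f a p))"

lemma functorial_homotopy_equivalence_imp_equivalent:
  "functorial_homotopy_equivalence X Y f \<Longrightarrow> Y a homotopy_equivalent_space X a"
  unfolding functorial_homotopy_equivalence_def homotopy_equivalence_map_def
    homotopy_equivalent_space_def by blast

end

theory Submission
  imports Defs
begin

text \<open>
  The product \<open>\<gamma> \<times> \<gamma>\<close> identifies the cells with compact convex polytopes in a vector space, on
  which \<open>T_fun\<close> is the convex function \<open>(a, b) \<mapsto> \<parallel>a - b\<parallel>\<^sup>2 / 2\<close>; on the intersection of two cells
  the transition is the identity or the swap of the two factors, hence linear.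

  The map \<open>f\<close> from the nerve sends the barycentre of a simplex \<open>\<sigma>\<close> to a minimiser of \<open>T_fun\<close> on
  the intersection of the cells in \<open>\<sigma>\<close> and is affine on the barycentric subdivision; the choice of
  minimisers makes it respect all sublevel sets at once.  It maps the closed dual block
  \<open>{\<alpha>. \<alpha> e is maximal}\<close> into the cell \<open>e\<close>.

  The inverse \<open>g\<close> comes from bump functions that are maximal on the cells and whose supports have the
  same nerve; it maps the cell \<open>e\<close> into the dual block of \<open>e\<close>.  So \<open>f \<circ> g\<close> preserves every cell
  and a straight-line homotopy in the cells joins it to the identity.  For \<open>g \<circ> f\<close> one moves
  linearly through the normalised product of \<open>\<alpha>\<close> and \<open>g (f \<alpha>)\<close>, whose support is contained in
  both supports.
\<close>

section \<open>Nerves of finite families\<close>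

lemma closed_closed_simplex:
  assumes "finite \<sigma>"
  shows "closed (closed_simplex \<sigma>)"
proof -
  have "closed_simplex \<sigma> = (\<Inter>v. {\<alpha>. 0 \<le> \<alpha> v}) \<inter> (\<Inter>v\<in>-\<sigma>. {\<alpha>. \<alpha> v = 0}) \<inter> {\<alpha>. (\<Sum>v\<in>\<sigma>. \<alpha> v) = 1}"
    by (auto simp: closed_simplex_def)
  also have "closed \<dots>"
    by (intro closed_Int closed_INT ballI closed_Collect_le closed_Collect_eq continuous_on_const
        continuous_on_sum continuous_on_product_coordinates)
  finally show ?thesis .
qed

text \<open>A finite union of closed sets is closed, so for finitely many simplices the coherent
  topology is the one inherited from the product. Continuity into the realisation can then be
  checked coordinate by coordinate.\<close>

lemma realisation_finite:
  assumes "finite K" and fin: "\<And>\<sigma>. \<sigma> \<in> K \<Longrightarrow> finite \<sigma>"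
  shows "realisation K = top_of_set (\<Union>\<sigma>\<in>K. closed_simplex \<sigma>)"
proof (rule topology_eq[THEN iffD2], intro allI iffI)
  let ?S = "\<Union>\<sigma>\<in>K. closed_simplex \<sigma>"
  fix U
  assume "openin (top_of_set ?S) U"
  then obtain O' where O': "open O'" "U = ?S \<inter> O'" by (auto simp: openin_open)
  have "openin (top_of_set (closed_simplex \<sigma>)) (U \<inter> closed_simplex \<sigma>)" if "\<sigma> \<in> K" for \<sigma>
  proof -
    have "U \<inter> closed_simplex \<sigma> = closed_simplex \<sigma> \<inter> O'" using O' that by auto
    then show ?thesis using O'(1) by (auto simp: openin_open)
  qed
  then show "openin (realisation K) U"
    using O' by (auto simp: openin_realisation)
next
  let ?S = "\<Union>\<sigma>\<in>K. closed_simplex \<sigma>"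
  fix U
  assume U: "openin (realisation K) U"
  have "closed (closed_simplex \<sigma> - U)" if "\<sigma> \<in> K" for \<sigma>
  proof -
    have "openin (top_of_set (closed_simplex \<sigma>)) (U \<inter> closed_simplex \<sigma>)"
      using U that by (auto simp: openin_realisation)
    then obtain O' where "open O'" "U \<inter> closed_simplex \<sigma> = closed_simplex \<sigma> \<inter> O'"
      by (auto simp: openin_open)
    moreover from this have "closed_simplex \<sigma> - U = closed_simplex \<sigma> \<inter> - O'" by blast
    ultimately show ?thesis using closed_closed_simplex[OF fin[OF that]] by auto
  qed
  then have "closed (\<Union>\<sigma>\<in>K. closed_simplex \<sigma> - U)" using assms(1) by blast
  moreover have "U = ?S \<inter> - (\<Union>\<sigma>\<in>K. closed_simplex \<sigma> - U)"
    using U by (auto simp: openin_realisation)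
  ultimately show "openin (top_of_set ?S) U" unfolding openin_open by blast
qed

lemma finite_nerve: "finite I \<Longrightarrow> finite (nerve I V)"
  by (rule finite_subset[of _ "Pow I"]) (auto simp: nerve_def)

lemma realisation_nerve:
  "finite I \<Longrightarrow> realisation (nerve I V) = top_of_set (\<Union>\<sigma>\<in>nerve I V. closed_simplex \<sigma>)"
  by (rule realisation_finite[OF finite_nerve]) (auto simp: nerve_def)

lemma nerve_subset: "\<sigma> \<in> nerve I V \<Longrightarrow> \<tau> \<subseteq> \<sigma> \<Longrightarrow> \<tau> \<noteq> {} \<Longrightarrow> \<tau> \<in> nerve I V"
  using INT_anti_mono[of \<tau> \<sigma> V V] finite_subset[of \<tau> \<sigma>] by (auto simp: nerve_def)

lemma nerve_cong: "(\<And>i. i \<in> I \<Longrightarrow> V i = W i) \<Longrightarrow> nerve I V = nerve I W"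
proof -
  assume eq: "\<And>i. i \<in> I \<Longrightarrow> V i = W i"
  have "(\<Inter>i\<in>\<sigma>. V i) = (\<Inter>i\<in>\<sigma>. W i)" if "\<sigma> \<subseteq> I" for \<sigma>
    by (rule INF_cong) (use that eq in auto)
  then show ?thesis unfolding nerve_def by (simp cong: conj_cong)
qed

text \<open>The support of \<open>\<alpha>\<close> is the smallest simplex that can contain it,
  which turns the union over all simplices into one condition on the support.\<close>

lemma mem_nerve_realisation:
  assumes "finite I"
  shows "\<alpha> \<in> (\<Union>\<sigma>\<in>nerve I V. closed_simplex \<sigma>) \<longleftrightarrow>
    (\<forall>e. 0 \<le> \<alpha> e) \<and> {e. \<alpha> e \<noteq> 0} \<in> nerve I V \<and> sum \<alpha> I = 1"
proof
  assume "\<alpha> \<in> (\<Union>\<sigma>\<in>nerve I V. closed_simplex \<sigma>)"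
  then obtain \<sigma> where \<sigma>: "\<sigma> \<in> nerve I V" "\<alpha> \<in> closed_simplex \<sigma>" by blast
  then have sub: "{e. \<alpha> e \<noteq> 0} \<subseteq> \<sigma>" and s: "sum \<alpha> \<sigma> = 1" and "\<sigma> \<subseteq> I"
    by (auto simp: closed_simplex_def nerve_def)
  have "{e. \<alpha> e \<noteq> 0} \<noteq> {}" using s by (auto intro: ccontr)
  moreover have "sum \<alpha> I = sum \<alpha> \<sigma>"
    by (rule sum.mono_neutral_right) (use \<open>\<sigma> \<subseteq> I\<close> sub assms in auto)
  ultimately show "(\<forall>e. 0 \<le> \<alpha> e) \<and> {e. \<alpha> e \<noteq> 0} \<in> nerve I V \<and> sum \<alpha> I = 1"
    using nerve_subset[OF \<sigma>(1) sub] s \<sigma>(2) by (auto simp: closed_simplex_def)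
next
  assume *: "(\<forall>e. 0 \<le> \<alpha> e) \<and> {e. \<alpha> e \<noteq> 0} \<in> nerve I V \<and> sum \<alpha> I = 1"
  then have "{e. \<alpha> e \<noteq> 0} \<subseteq> I" by (auto simp: nerve_def)
  then have "sum \<alpha> I = sum \<alpha> {e. \<alpha> e \<noteq> 0}"
    by (intro sum.mono_neutral_right) (use assms in auto)
  with * show "\<alpha> \<in> (\<Union>\<sigma>\<in>nerve I V. closed_simplex \<sigma>)"
    by (intro UN_I[of "{e. \<alpha> e \<noteq> 0}"]) (auto simp: closed_simplex_def)
qed

lemma continuous_map_fun_iff:
  "continuous_map X (euclidean :: ('i \<Rightarrow> real) topology) f \<longleftrightarrow>
     (\<forall>i. continuous_map X euclideanreal (\<lambda>x. f x i))"
  by (simp flip: euclidean_product_topology add: continuous_map_componentwise_UNIV)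

text \<open>The segment from \<open>f y\<close> to \<open>g y\<close> stays in the closed simplex
  spanned by the support of \<open>g y\<close>, so the straight-line homotopy never leaves the
  realisation.\<close>

lemma homotopic_nerve_maps:
  fixes f g :: "'b \<Rightarrow> 'i \<Rightarrow> real"
  assumes I: "finite I"
    and f: "continuous_map Y (realisation (nerve I V)) f"
    and g: "continuous_map Y (realisation (nerve I V)) g"
    and supp: "\<And>y e. y \<in> topspace Y \<Longrightarrow> f y e \<noteq> 0 \<Longrightarrow> g y e \<noteq> 0"
  shows "homotopic_with (\<lambda>_. True) Y (realisation (nerve I V)) f g"
proof -
  let ?S = "\<Union>\<sigma>\<in>nerve I V. closed_simplex \<sigma>"
  let ?h = "\<lambda>p e. (1 - fst p) * f (snd p) e + fst p * g (snd p) e"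
  have fc: "continuous_map Y euclideanreal (\<lambda>y. f y e)" 
    and gc: "continuous_map Y euclideanreal (\<lambda>y. g y e)" for e
    using f g by (auto simp: realisation_nerve[OF I] continuous_map_in_subtopology continuous_map_fun_iff)
  have fS: "f y \<in> ?S" and gS: "g y \<in> ?S" if "y \<in> topspace Y" for y
    using that continuous_map_image_subset_topspace[OF f] continuous_map_image_subset_topspace[OF g]
    unfolding topspace_realisation by blast+
  have "continuous_map (prod_topology (top_of_set {0..1}) Y) (top_of_set ?S) ?h"
  proof (subst continuous_map_in_subtopology, intro conjI)
    have fst': "continuous_map (prod_topology (top_of_set {0..1}) Y) euclideanreal fst"
      by (rule continuous_map_into_fulltopology[OF continuous_map_fst])
    show "continuous_map (prod_topology (top_of_set {0..1}) Y) euclidean ?h"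
      unfolding continuous_map_fun_iff
      by (intro allI continuous_intros fst' continuous_map_compose[OF continuous_map_snd fc, unfolded o_def]
          continuous_map_compose[OF continuous_map_snd gc, unfolded o_def]) auto
    show "?h \<in> topspace (prod_topology (top_of_set {0..1}) Y) \<rightarrow> ?S"
    proof
      fix p assume "p \<in> topspace (prod_topology (top_of_set {0..1::real}) Y)"
      then have t: "0 \<le> fst p" "fst p \<le> 1" and y: "snd p \<in> topspace Y" by auto
      note F = fS[OF y, unfolded mem_nerve_realisation[OF I]]
      note G = gS[OF y, unfolded mem_nerve_realisation[OF I]]
      have nn: "0 \<le> ?h p e" for e using t F G by simp
      have "sum (?h p) I = 1"
        using F G by (simp add: sum.distrib flip: sum_distrib_left)
      moreover from this have "{e. ?h p e \<noteq> 0} \<noteq> {}" by (auto intro: ccontr)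
      moreover have "{e. ?h p e \<noteq> 0} \<subseteq> {e. g (snd p) e \<noteq> 0}"
        using supp[OF y] by auto
      ultimately show "?h p \<in> ?S"
        unfolding mem_nerve_realisation[OF I] using nn G nerve_subset by blast
    qed
  qed
  then show ?thesis
    unfolding homotopic_with_def realisation_nerve[OF I]
    by (intro exI[of _ ?h]) auto
qed

lemma continuous_map_scaleR:
  fixes g :: "'a \<Rightarrow> 'b::real_normed_vector"
  assumes "continuous_map X euclideanreal f" "continuous_map X euclidean g"
  shows "continuous_map X euclidean (\<lambda>x. f x *\<^sub>R g x)"
  using assms by (simp add: continuous_map_atin tendsto_scaleR)

section \<open>Covers by convex cells with linear transitions\<close>

text \<open>On \<open>C e\<close> the map \<open>q\<close> parametrises the cell of
  \<open>e\<close>. The map \<open>\<Phi>\<close> makes \<open>X\<close> Hausdorff and supplies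
  distances to the cells. The transition \<open>L\<close> preserves \<open>q\<close> on the whole
  vector space, because it is applied to convex combinations of points of an overlap, which are not
  assumed to lie in the overlap again.\<close>

locale convex_cell_cover =
  fixes X :: "'a topology" and I :: "'i set"
    and C :: "'i \<Rightarrow> 'e::real_normed_vector set" and q :: "'e \<Rightarrow> 'a"
    and T :: "'a \<Rightarrow> real" and \<Phi> :: "'a \<Rightarrow> 'm::metric_space"
  assumes finite_I: "finite I"
    and compact_C: "e \<in> I \<Longrightarrow> compact (C e)"
    and C_nonempty: "e \<in> I \<Longrightarrow> C e \<noteq> {}"
    and continuous_q: "e \<in> I \<Longrightarrow> continuous_map (top_of_set (C e)) X q"
    and inj_q: "e \<in> I \<Longrightarrow> inj_on q (C e)"
    and transition: "e \<in> I \<Longrightarrow> e' \<in> I \<Longrightarrow> \<exists>L. linear L \<and> (\<forall>c. q (L c) = q c) \<and>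
      (\<forall>c\<in>C e. \<forall>c'\<in>C e'. q c = q c' \<longrightarrow> c' = L c)"
    and cover: "topspace X = (\<Union>e\<in>I. q ` C e)"
    and continuous_T: "continuous_map X euclideanreal T"
    and convex_sublevel: "e \<in> I \<Longrightarrow> convex {c \<in> C e. T (q c) \<le> a}"
    and continuous_\<Phi>: "continuous_map X euclidean \<Phi>"
    and inj_\<Phi>: "inj_on \<Phi> (topspace X)"
begin

section \<open>Cells and their charts\<close>

definition V :: "'i \<Rightarrow> 'a set" where "V e = q ` C e"
definition \<kappa> :: "'i \<Rightarrow> 'a \<Rightarrow> 'e" where "\<kappa> e = inv_into (C e) q"
definition \<Gamma> :: "real \<Rightarrow> 'a set" where "\<Gamma> a = {w \<in> topspace X. T w \<le> a}"
abbreviation N :: "real \<Rightarrow> 'i set set" where "N a \<equiv> nerve I (\<lambda>e. V e \<inter> \<Gamma> a)"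
abbreviation NS :: "real \<Rightarrow> ('i \<Rightarrow> real) set" where "NS a \<equiv> \<Union>\<sigma>\<in>N a. closed_simplex \<sigma>"

lemmas realisation_N = realisation_nerve[OF finite_I]
lemmas mem_NS = mem_nerve_realisation[OF finite_I]

lemma Hausdorff: "Hausdorff_space X"
  using Hausdorff_space_injective_preimage[OF _ continuous_\<Phi> inj_\<Phi>] Hausdorff_space_euclidean by blast

lemma compactin_V: "e \<in> I \<Longrightarrow> compactin X (V e)"
  unfolding V_def using compact_C
  by (intro image_compactin[OF _ continuous_q]) (auto simp: compactin_subtopology)

lemma closedin_V: "e \<in> I \<Longrightarrow> closedin X (V e)"
  using compactin_imp_closedin[OF Hausdorff compactin_V] .

lemma V_subset: "e \<in> I \<Longrightarrow> V e \<subseteq> topspace X"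
  using closedin_V closedin_subset by blast

lemma \<kappa>_mem: "w \<in> V e \<Longrightarrow> \<kappa> e w \<in> C e"
  unfolding V_def \<kappa>_def by (rule inv_into_into)

lemma q_\<kappa>: "w \<in> V e \<Longrightarrow> q (\<kappa> e w) = w"
  unfolding V_def \<kappa>_def by (rule f_inv_into_f)

lemma transition_\<kappa>:
  assumes "e \<in> I" "e' \<in> I"
  obtains L where "linear L" "\<And>c. q (L c) = q c" 
    "\<And>w. w \<in> V e \<Longrightarrow> w \<in> V e' \<Longrightarrow> \<kappa> e' w = L (\<kappa> e w)"
proof -
  obtain L where L: "linear L" "\<forall>c. q (L c) = q c"
      "\<forall>c\<in>C e. \<forall>c'\<in>C e'. q c = q c' \<longrightarrow> c' = L c"
    using transition[OF assms] by blast
  show ?thesis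
    by (rule that[of L]) (use L \<kappa>_mem q_\<kappa> in auto)
qed

text \<open>A continuous bijection from a compact space onto a Hausdorff space is a homeomorphism,
  and \<open>\<kappa> e\<close> is its inverse.\<close>

lemma continuous_\<kappa>:
  assumes "e \<in> I"
  shows "continuous_map (subtopology X (V e)) euclidean (\<kappa> e)"
proof -
  have "homeomorphic_map (top_of_set (C e)) (subtopology X (V e)) q"
  proof (rule continuous_imp_homeomorphic_map)
    show "continuous_map (top_of_set (C e)) (subtopology X (V e)) q"
      using continuous_q[OF assms] by (auto simp: continuous_map_in_subtopology V_def)
    show "compact_space (top_of_set (C e))"
      using compact_C[OF assms] by (simp add: compact_space_subtopology)
    show "Hausdorff_space (subtopology X (V e))"
      using Hausdorff Hausdorff_space_subtopology by blast
    show "q ` topspace (top_of_set (C e)) = topspace (subtopology X (V e))"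
      using V_subset[OF assms] by (auto simp: V_def)
    show "inj_on q (topspace (top_of_set (C e)))" using inj_q[OF assms] by simp
  qed
  then obtain g where g: "homeomorphic_maps (top_of_set (C e)) (subtopology X (V e)) q g"
    unfolding homeomorphic_map_maps by blast
  have "continuous_map (subtopology X (V e)) (top_of_set (C e)) g"
    using g by (simp add: homeomorphic_maps_def)
  moreover have "\<kappa> e w = g w" if "w \<in> topspace (subtopology X (V e))" for w
  proof -
    have "w \<in> V e" using that by simp
    then have "q (\<kappa> e w) = w" "\<kappa> e w \<in> C e" using q_\<kappa> \<kappa>_mem by auto
    then show ?thesis using g by (metis homeomorphic_maps_def topspace_euclidean_subtopology)
  qed
  ultimately have "continuous_map (subtopology X (V e)) (top_of_set (C e)) (\<kappa> e)"
    using continuous_map_eq by metis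
  then show ?thesis by (rule continuous_map_into_fulltopology)
qed

section \<open>The map from the nerve to the space\<close>

definition faces :: "'i set set" where "faces = {\<sigma>. \<sigma> \<subseteq> I \<and> \<sigma> \<noteq> {}}"

lemma finite_faces: "finite faces"
  by (rule finite_subset[of _ "Pow I"]) (auto simp: faces_def finite_I)

lemma face_finite: "\<sigma> \<in> faces \<Longrightarrow> finite \<sigma>"
  using finite_I finite_subset by (auto simp: faces_def)

text \<open>Minimality puts the chosen point of \<open>\<sigma>\<close> into every sublevel set in which \<open>\<sigma>\<close> is a simplex
  of the nerve; this makes the map to \<open>X\<close> independent of the level.\<close>

definition center :: "'i set \<Rightarrow> 'a" where
  "center \<sigma> = (SOME w. w \<in> (\<Inter>e\<in>\<sigma>. V e) \<and> (\<forall>w'\<in>(\<Inter>e\<in>\<sigma>. V e). T w \<le> T w'))"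

text \<open>The intersection of the cells is compact, so \<open>T\<close> attains its minimum there.
  As \<open>\<sigma>\<close> is a simplex of \<open>N a\<close>, some point of the intersection has
  value at most \<open>a\<close>, hence so does the minimiser.\<close>

lemma center:
  assumes "\<sigma> \<in> N a"
  shows "center \<sigma> \<in> (\<Inter>e\<in>\<sigma>. V e)" "T (center \<sigma>) \<le> a"
proof -
  let ?W = "\<Inter>e\<in>\<sigma>. V e"
  obtain w where \<sigma>: "\<sigma> \<subseteq> I" "\<sigma> \<noteq> {}" "finite \<sigma>" and w: "w \<in> ?W" "w \<in> \<Gamma> a"
    using assms unfolding nerve_def by (auto split: if_splits)
  obtain e where e: "e \<in> \<sigma>" using \<sigma> by blast
  have "closedin X ?W" using \<sigma> closedin_V by (intro closedin_INT) auto
  moreover have "compactin X (V e)" "?W \<subseteq> V e" using e \<sigma> compactin_V by auto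
  ultimately have "compactin X ?W" using closed_compactin by blast
  then have "compact (T ` ?W)"
    using image_compactin[OF _ continuous_T] by simp
  then obtain w0 where w0: "w0 \<in> ?W \<and> (\<forall>w'\<in>?W. T w0 \<le> T w')"
    using compact_attains_inf[of "T ` ?W"] w(1) by blast
  then have *: "center \<sigma> \<in> ?W \<and> (\<forall>w'\<in>?W. T (center \<sigma>) \<le> T w')"
    unfolding center_def by (rule someI)
  then show "center \<sigma> \<in> ?W" by blast
  show "T (center \<sigma>) \<le> a" using * w by (force simp: \<Gamma>_def)
qed

text \<open>The weights are positive exactly on the flag of superlevel sets of \<open>\<alpha>\<close>, i.e. on the
  vertices of the simplex of the barycentric subdivision that contains \<open>\<alpha>\<close>.\<close>

definition weight :: "('i \<Rightarrow> real) \<Rightarrow> 'i set \<Rightarrow> real" where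
  "weight \<alpha> \<sigma> = (\<Prod>e\<in>\<sigma>. \<alpha> e) * (\<Prod>e\<in>\<sigma>. \<Prod>e'\<in>I - \<sigma>. max 0 (\<alpha> e - \<alpha> e'))"

text \<open>The indices whose closed dual block contains \<open>\<alpha>\<close>. They form the
  smallest set in the flag of superlevel sets.\<close>

definition top_indices :: "('i \<Rightarrow> real) \<Rightarrow> 'i set" where
  "top_indices \<alpha> = {e \<in> I. \<forall>e'\<in>I. \<alpha> e' \<le> \<alpha> e}"

definition weight_sum :: "('i \<Rightarrow> real) \<Rightarrow> real" where
  "weight_sum \<alpha> = (\<Sum>\<sigma>\<in>faces. weight \<alpha> \<sigma>)"

lemma weight_nonneg: "(\<And>e. 0 \<le> \<alpha> e) \<Longrightarrow> 0 \<le> weight \<alpha> \<sigma>"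
  unfolding weight_def by (intro mult_nonneg_nonneg prod_nonneg) auto

text \<open>A top index outside \<open>\<sigma>\<close> would make one of the factors
  \<open>max 0 (\<alpha> e - \<alpha> e')\<close> vanish. So for a point of the nerve, every center
  of non-zero weight lies in all cells whose index is a top index.\<close>

lemma weight_support:
  assumes "\<sigma> \<in> faces" "weight \<alpha> \<sigma> \<noteq> 0"
  shows "\<sigma> \<subseteq> {e. \<alpha> e \<noteq> 0}" "top_indices \<alpha> \<subseteq> \<sigma>"
proof -
  have fin: "finite \<sigma>" "finite (I - \<sigma>)" using face_finite[OF assms(1)] finite_I by auto
  show "\<sigma> \<subseteq> {e. \<alpha> e \<noteq> 0}" using assms(2) fin by (auto simp: weight_def)
  obtain e0 where e0: "e0 \<in> \<sigma>" "e0 \<in> I" using assms(1) by (auto simp: faces_def)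
  show "top_indices \<alpha> \<subseteq> \<sigma>"
  proof
    fix e assume e: "e \<in> top_indices \<alpha>"
    show "e \<in> \<sigma>"
    proof (rule ccontr)
      assume "e \<notin> \<sigma>"
      then have "e \<in> I - \<sigma>" using e by (simp add: top_indices_def)
      with assms(2) fin e0 have "max 0 (\<alpha> e0 - \<alpha> e) \<noteq> 0"
        unfolding weight_def by (simp add: prod_zero_iff)
      then show False using e e0 by (auto simp: top_indices_def)
    qed
  qed
qed

lemma top_indices_nonempty: "\<alpha> \<in> NS a \<Longrightarrow> top_indices \<alpha> \<noteq> {}"
proof -
  assume "\<alpha> \<in> NS a"
  then have "I \<noteq> {}" unfolding mem_NS by auto
  then have "Max (\<alpha> ` I) \<in> \<alpha> ` I" using finite_I by simp
  then obtain e where "e \<in> I" "\<alpha> e = Max (\<alpha> ` I)" by force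
  then have "e \<in> top_indices \<alpha>" using finite_I by (simp add: top_indices_def)
  then show ?thesis by blast
qed

lemma top_indices_pos:
  assumes "\<alpha> \<in> NS a" "e \<in> top_indices \<alpha>"
  shows "0 < \<alpha> e"
proof (rule ccontr)
  assume "\<not> 0 < \<alpha> e"
  then have "sum \<alpha> I \<le> 0"
    using assms(2) by (intro sum_nonpos) (force simp: top_indices_def)
  then show False using assms(1) unfolding mem_NS by simp
qed

text \<open>The set of top indices itself has positive weight: its coordinates are positive and
  strictly exceed all others.\<close>

lemma weight_sum_pos:
  assumes "\<alpha> \<in> NS a"
  shows "0 < weight_sum \<alpha>"
proof -
  let ?M = "top_indices \<alpha>"
  have M: "?M \<in> faces" using top_indices_nonempty[OF assms] by (auto simp: faces_def top_indices_def)
  have "\<alpha> e' < \<alpha> e" if "e \<in> ?M" "e' \<in> I - ?M" for e e'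
    using that by (force simp: top_indices_def)
  then have "0 < weight \<alpha> ?M"
    unfolding weight_def using top_indices_pos[OF assms] by (intro mult_pos_pos prod_pos) auto
  moreover have "0 \<le> weight \<alpha> \<sigma>" for \<sigma> using assms unfolding mem_NS by (intro weight_nonneg) auto
  ultimately show ?thesis
    unfolding weight_sum_def using finite_faces M by (intro sum_pos2[of _ ?M]) auto
qed

text \<open>The convex combination of centers, computed in the chart of \<open>e\<close>. It is
  meaningful when \<open>e\<close> is a top index of a point of the nerve: then the centers outside
  the cell, where \<open>inv_into\<close> is arbitrary, have weight zero.\<close>

definition lifted :: "'i \<Rightarrow> ('i \<Rightarrow> real) \<Rightarrow> 'e" where
  "lifted e \<alpha> = (\<Sum>\<sigma>\<in>faces. (weight \<alpha> \<sigma> / weight_sum \<alpha>) *\<^sub>R \<kappa> e (center \<sigma>))"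

text \<open>After discarding zero weights, all centers lie in the part of the cell \<open>e\<close>
  below level \<open>a\<close>, which is convex in the chart.\<close>

lemma lifted_mem:
  assumes \<alpha>: "\<alpha> \<in> NS a" and e: "e \<in> top_indices \<alpha>"
  shows "lifted e \<alpha> \<in> {c \<in> C e. T (q c) \<le> a}"
proof -
  let ?F = "{\<sigma> \<in> faces. weight \<alpha> \<sigma> \<noteq> 0}"
  have e_I: "e \<in> I" using e by (simp add: top_indices_def)
  have fin: "finite ?F" using finite_faces by simp
  have W: "(\<Sum>\<sigma>\<in>?F. weight \<alpha> \<sigma>) = weight_sum \<alpha>"
    unfolding weight_sum_def by (rule sum.mono_neutral_left) (use finite_faces in auto)
  have nn: "0 \<le> weight \<alpha> \<sigma>" for \<sigma> using \<alpha> unfolding mem_NS by (intro weight_nonneg) auto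
  have "(\<Sum>\<sigma>\<in>?F. (weight \<alpha> \<sigma> / weight_sum \<alpha>) *\<^sub>R \<kappa> e (center \<sigma>)) \<in> {c \<in> C e. T (q c) \<le> a}"
  proof (rule convex_sum[OF fin convex_sublevel[OF e_I]])
    show "(\<Sum>\<sigma>\<in>?F. weight \<alpha> \<sigma> / weight_sum \<alpha>) = 1"
      using W weight_sum_pos[OF \<alpha>] by (simp flip: sum_divide_distrib)
    show "0 \<le> weight \<alpha> \<sigma> / weight_sum \<alpha>" for \<sigma>
      using nn weight_sum_pos[OF \<alpha>] by simp
    fix \<sigma> assume \<sigma>: "\<sigma> \<in> ?F"
    have "{e. \<alpha> e \<noteq> 0} \<in> N a" using \<alpha> unfolding mem_NS by blast
    moreover have "\<sigma> \<noteq> {}" "\<sigma> \<subseteq> {e. \<alpha> e \<noteq> 0}" "e \<in> \<sigma>"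
      using \<sigma> weight_support[of \<sigma> \<alpha>] e by (auto simp: faces_def)
    ultimately have "\<sigma> \<in> N a" by (blast intro: nerve_subset)
    from center[OF this] show "\<kappa> e (center \<sigma>) \<in> {c \<in> C e. T (q c) \<le> a}"
      using \<open>e \<in> \<sigma>\<close> \<kappa>_mem q_\<kappa> by auto
  qed
  also have "(\<Sum>\<sigma>\<in>?F. (weight \<alpha> \<sigma> / weight_sum \<alpha>) *\<^sub>R \<kappa> e (center \<sigma>)) = lifted e \<alpha>"
    unfolding lifted_def by (rule sum.mono_neutral_left) (use finite_faces in auto)
  finally show ?thesis .
qed

text \<open>All centers of non-zero weight lie in both cells, so a single linear transition carries
  one combination to the other term by term.\<close>

lemma q_lifted_cong:
  assumes \<alpha>: "\<alpha> \<in> NS a" and e: "e \<in> top_indices \<alpha>" "e' \<in> top_indices \<alpha>"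
  shows "q (lifted e \<alpha>) = q (lifted e' \<alpha>)"
proof -
  have e_I: "e \<in> I" "e' \<in> I" using e by (auto simp: top_indices_def)
  obtain L where L: "linear L" "\<And>c. q (L c) = q c" 
    "\<And>w. w \<in> V e \<Longrightarrow> w \<in> V e' \<Longrightarrow> \<kappa> e' w = L (\<kappa> e w)"
    using transition_\<kappa>[OF e_I] by metis
  have eq: "(weight \<alpha> \<sigma> / weight_sum \<alpha>) *\<^sub>R \<kappa> e' (center \<sigma>) =
    (weight \<alpha> \<sigma> / weight_sum \<alpha>) *\<^sub>R L (\<kappa> e (center \<sigma>))" if \<sigma>: "\<sigma> \<in> faces" for \<sigma>
  proof (cases "weight \<alpha> \<sigma> = 0")
    case False
    have "{e. \<alpha> e \<noteq> 0} \<in> N a" using \<alpha> unfolding mem_NS by blast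
    moreover have "\<sigma> \<noteq> {}" "\<sigma> \<subseteq> {e. \<alpha> e \<noteq> 0}" "e \<in> \<sigma>" "e' \<in> \<sigma>"
      using \<sigma> weight_support[OF \<sigma> False] e by (auto simp: faces_def)
    ultimately have "\<sigma> \<in> N a" by (blast intro: nerve_subset)
    with center(1)[OF this] \<open>e \<in> \<sigma>\<close> \<open>e' \<in> \<sigma>\<close> show ?thesis using L(3) by auto
  qed simp
  then have "lifted e' \<alpha> = L (lifted e \<alpha>)"
    unfolding lifted_def linear_sum[OF L(1)] linear_scale[OF L(1)] by (intro sum.cong eq) auto
  then show ?thesis using L(2) by simp
qed

definition realise :: "('i \<Rightarrow> real) \<Rightarrow> 'a" where
  "realise \<alpha> = q (lifted (SOME e. e \<in> top_indices \<alpha>) \<alpha>)"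

lemma realise_eq:
  assumes "\<alpha> \<in> NS a" "e \<in> top_indices \<alpha>"
  shows "realise \<alpha> = q (lifted e \<alpha>)"
  unfolding realise_def using assms by (intro q_lifted_cong) (auto intro: someI)

lemma realise_mem_V:
  assumes "\<alpha> \<in> NS a" "e \<in> top_indices \<alpha>"
  shows "realise \<alpha> \<in> V e"
  using lifted_mem[OF assms] by (simp add: realise_eq[OF assms] V_def)

lemma continuous_lifted: "continuous_on {\<alpha>. weight_sum \<alpha> \<noteq> 0} (lifted e)"
proof -
  have w: "continuous_on UNIV (\<lambda>\<alpha>. weight \<alpha> \<sigma>)" for \<sigma>
    unfolding weight_def by (intro continuous_intros continuous_on_product_coordinates)
  then have "continuous_on UNIV weight_sum"
    unfolding weight_sum_def by (intro continuous_on_sum)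
  with w show ?thesis
    unfolding lifted_def by (intro continuous_intros) (auto intro: continuous_on_subset)
qed

lemma topspace_\<Gamma>: "topspace (subtopology X (\<Gamma> a)) = \<Gamma> a"
  by (auto simp: \<Gamma>_def)

text \<open>The map is pasted from finitely many closed dual blocks; on the block of
  \<open>e\<close> it is \<open>lifted e\<close> followed by \<open>q\<close>.\<close>

lemma continuous_realise:
  "continuous_map (realisation (N a)) (subtopology X (\<Gamma> a)) realise"
  unfolding realisation_N
proof (rule pasting_lemma_closed[where I = I and T = "\<lambda>e. {\<alpha> \<in> NS a. e \<in> top_indices \<alpha>}"
      and f = "\<lambda>e \<alpha>. q (lifted e \<alpha>)"])
  show "closedin (top_of_set (NS a)) {\<alpha> \<in> NS a. e \<in> top_indices \<alpha>}" if "e \<in> I" for e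
  proof -
    have "{\<alpha> \<in> NS a. e \<in> top_indices \<alpha>} = NS a \<inter> (\<Inter>e'\<in>I. {\<alpha>. \<alpha> e' \<le> \<alpha> e})"
      using that by (auto simp: top_indices_def)
    moreover have "closed (\<Inter>e'\<in>I. {\<alpha>. \<alpha> e' \<le> (\<alpha> e :: real)})"
      by (intro closed_INT ballI closed_Collect_le continuous_on_product_coordinates)
    ultimately show ?thesis using closedin_closed_Int by simp
  qed
  show "continuous_map (subtopology (top_of_set (NS a)) {\<alpha> \<in> NS a. e \<in> top_indices \<alpha>})
      (subtopology X (\<Gamma> a)) (\<lambda>\<alpha>. q (lifted e \<alpha>))" if "e \<in> I" for e
  proof -
    let ?D = "{\<alpha> \<in> NS a. e \<in> top_indices \<alpha>}"
    have "continuous_on ?D (lifted e)"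
    proof (rule continuous_on_subset[OF continuous_lifted], rule subsetI, rule CollectI)
      fix \<alpha> assume "\<alpha> \<in> ?D"
      then have "\<alpha> \<in> NS a" by blast
      from weight_sum_pos[OF this] show "weight_sum \<alpha> \<noteq> 0" by simp
    qed
    then have "continuous_map (top_of_set ?D) (top_of_set (C e)) (lifted e)"
      using lifted_mem by (auto simp: continuous_map_in_subtopology)
    from continuous_map_compose[OF this continuous_q[OF that]]
    have "continuous_map (top_of_set ?D) X (\<lambda>\<alpha>. q (lifted e \<alpha>))" by (simp add: o_def)
    moreover have "subtopology (top_of_set (NS a)) ?D = top_of_set ?D"
      by (simp add: subtopology_subtopology Int_absorb1 subset_iff)
    moreover have "q (lifted e \<alpha>) \<in> \<Gamma> a" if "\<alpha> \<in> ?D" for \<alpha>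
      using lifted_mem[of \<alpha> a e] that V_subset[OF \<open>e \<in> I\<close>] by (auto simp: \<Gamma>_def V_def)
    ultimately show ?thesis by (auto simp: continuous_map_in_subtopology)
  qed
  show "q (lifted e \<alpha>) = q (lifted e' \<alpha>)"
    if "\<alpha> \<in> topspace (top_of_set (NS a)) \<inter> {\<alpha> \<in> NS a. e \<in> top_indices \<alpha>} \<inter> {\<alpha> \<in> NS a. e' \<in> top_indices \<alpha>}" for e e' \<alpha>
    using that q_lifted_cong by blast
  show "\<exists>e. e \<in> I \<and> \<alpha> \<in> {\<alpha> \<in> NS a. e \<in> top_indices \<alpha>} \<and> realise \<alpha> = q (lifted e \<alpha>)"
    if "\<alpha> \<in> topspace (top_of_set (NS a))" for \<alpha>
    using that top_indices_nonempty[of \<alpha> a] realise_eq[of \<alpha> a]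
    by (auto simp: top_indices_def)
qed (rule finite_I)

section \<open>The map from the space to the nerve\<close>

text \<open>Despite its name this is the distance to the cell \<open>e\<close>, measured after the
  injection \<open>\<Phi>\<close> into a metric space.\<close>

definition depth :: "'i \<Rightarrow> 'a \<Rightarrow> real" where
  "depth e w = infdist (\<Phi> w) (\<Phi> ` V e)"

lemma depth_nonneg: "0 \<le> depth e w"
  by (simp add: depth_def infdist_nonneg)

lemma continuous_depth: "continuous_map X euclideanreal (depth e)"
proof -
  have "continuous_map euclidean euclideanreal (\<lambda>y. infdist y (\<Phi> ` V e))"
    by (simp add: continuous_on_infdist)
  from continuous_map_compose[OF continuous_\<Phi> this] show ?thesis
    by (simp add: depth_def[abs_def] o_def)
qed

text \<open>The image of the cell under \<open>\<Phi>\<close> is compact, hence closed, so distance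
  zero means membership; injectivity of \<open>\<Phi>\<close> pulls this back to
  \<open>X\<close>.\<close>

lemma depth_eq_0_iff:
  assumes "e \<in> I" "w \<in> topspace X"
  shows "depth e w = 0 \<longleftrightarrow> w \<in> V e"
proof -
  have "compact (\<Phi> ` V e)"
    using image_compactin[OF compactin_V[OF assms(1)] continuous_\<Phi>] by simp
  then have "closed (\<Phi> ` V e)" by (rule compact_imp_closed)
  moreover have "\<Phi> ` V e \<noteq> {}" using C_nonempty[OF assms(1)] by (simp add: V_def)
  ultimately have "depth e w = 0 \<longleftrightarrow> \<Phi> w \<in> \<Phi> ` V e"
    unfolding depth_def using in_closed_iff_infdist_zero by blast
  also have "\<dots> \<longleftrightarrow> w \<in> V e"
    using inj_on_image_mem_iff[OF inj_\<Phi> assms(2) V_subset[OF assms(1)]] .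
  finally show ?thesis .
qed

text \<open>The radius is so small that the neighbourhoods \<open>depth e w < radius a w\<close> of the cells have
  the same nerve as the cells themselves.\<close>

definition radius :: "real \<Rightarrow> 'a \<Rightarrow> real" where
  "radius a w = (\<Prod>\<sigma>\<in>faces - N a. min 1 (\<Sum>e\<in>\<sigma>. depth e w)) / (real (card I) + 1)"

definition bump :: "real \<Rightarrow> 'a \<Rightarrow> 'i \<Rightarrow> real" where
  "bump a w e = (if e \<in> I then max 0 (radius a w - depth e w) else 0)"

definition classify :: "real \<Rightarrow> 'a \<Rightarrow> 'i \<Rightarrow> real" where
  "classify a w e = bump a w e / sum (bump a w) I"

text \<open>A point of \<open>\<Gamma> a\<close> cannot lie in all cells of an index set that is not
  a simplex of \<open>N a\<close>, so each factor of the product is positive.\<close>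

lemma radius_pos:
  assumes "w \<in> \<Gamma> a"
  shows "0 < radius a w"
proof -
  have wX: "w \<in> topspace X" using assms by (simp add: \<Gamma>_def)
  have "0 < (\<Sum>e\<in>\<sigma>. depth e w)" if \<sigma>: "\<sigma> \<in> faces - N a" for \<sigma>
  proof -
    have "\<exists>e\<in>\<sigma>. w \<notin> V e"
    proof (rule ccontr)
      assume "\<not> (\<exists>e\<in>\<sigma>. w \<notin> V e)"
      then have "w \<in> (\<Inter>e\<in>\<sigma>. V e \<inter> \<Gamma> a)" using assms by blast
      then have "\<sigma> \<in> N a" using \<sigma> face_finite[of \<sigma>] unfolding nerve_def faces_def by blast
      then show False using \<sigma> by blast
    qed
    then obtain e where e: "e \<in> \<sigma>" "w \<notin> V e" by blast
    then have "depth e w \<noteq> 0" using depth_eq_0_iff[OF _ wX] \<sigma> by (auto simp: faces_def)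
    then have "0 < depth e w" using depth_nonneg[of e w] by simp
    then show ?thesis using e(1) \<sigma> face_finite depth_nonneg by (intro sum_pos2[of \<sigma> e]) auto
  qed
  then show ?thesis unfolding radius_def by (intro divide_pos_pos prod_pos) auto
qed

text \<open>If \<open>\<sigma>\<close> were not a simplex, its sum of depths would bound the
  numerator of the radius, since \<open>min 1\<close> keeps the other factors at most 1. Positive
  bumps mean depths below the radius, so that sum is at most \<open>card I\<close> times the radius.
  The summand 1 in the denominator makes the two bounds contradictory.\<close>

lemma face_of_bump_pos:
  assumes w: "w \<in> \<Gamma> a" and \<sigma>: "\<sigma> \<in> faces" and pos: "\<And>e. e \<in> \<sigma> \<Longrightarrow> bump a w e \<noteq> 0"
  shows "\<sigma> \<in> N a"
proof (rule ccontr)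
  assume bad: "\<sigma> \<notin> N a"
  let ?s = "\<lambda>\<sigma>. min 1 (\<Sum>e\<in>\<sigma>. depth e w)"
  have s: "0 \<le> ?s \<tau>" "?s \<tau> \<le> 1" for \<tau> using depth_nonneg by (auto simp: sum_nonneg)
  have fin: "finite (faces - N a)" using finite_faces by simp
  have "radius a w * (real (card I) + 1) = (\<Prod>\<tau>\<in>faces - N a. ?s \<tau>)"
    by (simp add: radius_def)
  also have "\<dots> = ?s \<sigma> * (\<Prod>\<tau>\<in>faces - N a - {\<sigma>}. ?s \<tau>)"
    using \<sigma> bad fin by (simp add: prod.remove)
  also have "\<dots> \<le> ?s \<sigma> * 1" using s by (intro mult_left_mono prod_le_1) auto
  also have "\<dots> \<le> (\<Sum>e\<in>\<sigma>. depth e w)" by simp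
  also have "\<dots> \<le> (\<Sum>e\<in>\<sigma>. radius a w)"
    using pos by (intro sum_mono) (force simp: bump_def split: if_splits)
  also have "\<dots> \<le> real (card I) * radius a w"
    using card_mono[OF finite_I, of \<sigma>] \<sigma> radius_pos[OF w] by (simp add: faces_def mult_right_mono)
  finally show False using radius_pos[OF w] by (simp add: algebra_simps)
qed

text \<open>The radius at \<open>w\<close> is common to all indices, so the bump is largest where
  the depth vanishes.\<close>

lemma bump_max:
  assumes "w \<in> V e" "e \<in> I" "w \<in> \<Gamma> a"
  shows "bump a w e = radius a w" "bump a w e' \<le> bump a w e"
proof -
  have "depth e w = 0" using assms depth_eq_0_iff by (simp add: \<Gamma>_def)
  then show "bump a w e = radius a w" "bump a w e' \<le> bump a w e"
    using radius_pos[OF assms(3)] depth_nonneg[of e' w] assms(2) by (auto simp: bump_def)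
qed

lemma bump_nonneg: "0 \<le> bump a w e"
  by (simp add: bump_def)

lemma ex_cell: "w \<in> \<Gamma> a \<Longrightarrow> \<exists>e\<in>I. w \<in> V e"
  using cover by (auto simp: \<Gamma>_def V_def)

lemma sum_bump_pos:
  assumes "w \<in> \<Gamma> a"
  shows "0 < sum (bump a w) I"
proof -
  obtain e where "e \<in> I" "w \<in> V e" using ex_cell[OF assms] by blast
  with bump_max(1)[of w e a] radius_pos assms bump_nonneg finite_I show ?thesis
    by (intro sum_pos2[of _ e]) auto
qed

lemma classify_mem:
  assumes "w \<in> \<Gamma> a"
  shows "classify a w \<in> NS a"
  unfolding mem_NS
proof (intro conjI allI)
  note S = sum_bump_pos[OF assms]
  show "0 \<le> classify a w e" for e using S bump_nonneg by (simp add: classify_def)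
  show sum1: "sum (classify a w) I = 1" using S by (simp add: classify_def flip: sum_divide_distrib)
  have "{e. classify a w e \<noteq> 0} \<in> faces"
  proof -
    have "{e. classify a w e \<noteq> 0} \<noteq> {}" using sum1 by (auto intro: ccontr)
    then show ?thesis by (auto simp: faces_def classify_def bump_def split: if_splits)
  qed
  then show "{e. classify a w e \<noteq> 0} \<in> N a"
    by (rule face_of_bump_pos[OF assms]) (auto simp: classify_def)
qed

lemma top_indices_classify:
  assumes "w \<in> V e" "e \<in> I" "w \<in> \<Gamma> a"
  shows "e \<in> top_indices (classify a w)"
  using bump_max[OF assms] sum_bump_pos[OF assms(3)] assms(2)
  by (auto simp: top_indices_def classify_def divide_right_mono)

lemma continuous_classify:
  "continuous_map (subtopology X (\<Gamma> a)) (realisation (N a)) (classify a)"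
proof -
  have "continuous_map X euclideanreal (radius a)"
    unfolding radius_def using finite_faces face_finite
    by (intro continuous_intros continuous_depth) auto
  then have b: "continuous_map X euclideanreal (\<lambda>w. bump a w e)" for e
    unfolding bump_def by (cases "e \<in> I") (auto intro!: continuous_intros continuous_depth)
  have "continuous_map (subtopology X (\<Gamma> a)) euclideanreal (\<lambda>w. classify a w e)" for e
    unfolding classify_def using finite_I sum_bump_pos
    by (intro continuous_intros continuous_map_from_subtopology b) (auto simp: less_imp_neq[symmetric])
  then show ?thesis
    unfolding realisation_N continuous_map_in_subtopology continuous_map_fun_iff
    using classify_mem by (auto simp: topspace_\<Gamma>)
qed

section \<open>The two homotopies\<close>

text \<open>In each chart one moves along the segment from \<open>h w\<close> to \<open>w\<close>,
  which stays below level \<open>a\<close> by convexity. Linear transitions map segments to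
  segments, so the choices agree on overlaps and paste over the closed sets
  \<open>Z e\<close>.\<close>

lemma homotopic_id_if_cell_preserving:
  assumes h: "continuous_map (subtopology X (\<Gamma> a)) (subtopology X (\<Gamma> a)) h"
    and cells: "\<And>e w. e \<in> I \<Longrightarrow> w \<in> V e \<Longrightarrow> w \<in> \<Gamma> a \<Longrightarrow> h w \<in> V e"
  shows "homotopic_with (\<lambda>_. True) (subtopology X (\<Gamma> a)) (subtopology X (\<Gamma> a)) h id"
proof -
  let ?G = "subtopology X (\<Gamma> a)"
  let ?P = "prod_topology (top_of_set {0..1::real}) ?G"
  define seg where "seg e p = (1 - fst p) *\<^sub>R \<kappa> e (h (snd p)) + fst p *\<^sub>R \<kappa> e (snd p)"
    for e and p :: "real \<times> 'a"
  define Z where "Z e = {0..1::real} \<times> (V e \<inter> \<Gamma> a)" for e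
  have h\<Gamma>: "h w \<in> \<Gamma> a" if "w \<in> \<Gamma> a" for w
    using continuous_map_image_subset_topspace[OF h] that unfolding topspace_\<Gamma> by blast
  have seg_mem: "seg e p \<in> {c \<in> C e. T (q c) \<le> a}" if "e \<in> I" "p \<in> Z e" for e p
  proof -
    have p: "0 \<le> fst p" "fst p \<le> 1" "snd p \<in> V e" "snd p \<in> \<Gamma> a" using that(2) by (auto simp: Z_def)
    then have "\<kappa> e (snd p) \<in> {c \<in> C e. T (q c) \<le> a}" "\<kappa> e (h (snd p)) \<in> {c \<in> C e. T (q c) \<le> a}"
      using cells[OF that(1)] h\<Gamma> \<kappa>_mem q_\<kappa> by (auto simp: \<Gamma>_def)
    with p show ?thesis unfolding seg_def
      by (intro convexD[OF convex_sublevel[OF that(1)]]) auto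
  qed
  have seg_cong: "q (seg e p) = q (seg e' p)" if e: "e \<in> I" "e' \<in> I" and pZ: "p \<in> Z e" "p \<in> Z e'" for e e' p
  proof -
    obtain L where L: "linear L" "\<And>c. q (L c) = q c" 
      "\<And>w. w \<in> V e \<Longrightarrow> w \<in> V e' \<Longrightarrow> \<kappa> e' w = L (\<kappa> e w)"
      using transition_\<kappa>[OF e] by metis
    have p: "snd p \<in> V e" "snd p \<in> V e'" "snd p \<in> \<Gamma> a" using pZ by (auto simp: Z_def)
    have "seg e' p = L (seg e p)"
      using L(3) p cells[OF e(1)] cells[OF e(2)]
      unfolding seg_def linear_add[OF L(1)] linear_scale[OF L(1)] by simp
    then show ?thesis using L(2) by simp
  qed
  define H where "H p = q (seg (SOME e. e \<in> I \<and> p \<in> Z e) p)" for p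
  have ex: "\<exists>e. e \<in> I \<and> p \<in> Z e" if "p \<in> topspace ?P" for p
    using that ex_cell[of "snd p" a] by (auto simp: topspace_\<Gamma> Z_def)
  have H_eq: "H p = q (seg e p)" if "e \<in> I" "p \<in> Z e" for e p
    unfolding H_def using someI[of "\<lambda>e. e \<in> I \<and> p \<in> Z e" e] that by (intro seg_cong) auto
  have "continuous_map ?P ?G H"
  proof (rule pasting_lemma_closed[OF finite_I, where T = Z and f = "\<lambda>e p. q (seg e p)"])
    fix e assume e: "e \<in> I"
    have "closedin ?G (V e \<inter> \<Gamma> a)" using closedin_V[OF e] closedin_subtopology by blast
    then show "closedin ?P (Z e)" unfolding Z_def closedin_prod_Times_iff by simp
    let ?Q = "subtopology ?P (Z e)"
    have tQ: "topspace ?Q \<subseteq> Z e" by simp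
    have fst': "continuous_map ?Q euclideanreal fst"
      by (intro continuous_map_from_subtopology continuous_map_into_fulltopology[OF continuous_map_fst])
    have snd_G: "continuous_map ?Q ?G snd"
      by (intro continuous_map_from_subtopology continuous_map_snd)
    have "continuous_map ?Q X snd" "continuous_map ?Q X (h \<circ> snd)"
      using continuous_map_into_fulltopology[OF snd_G]
        continuous_map_into_fulltopology[OF continuous_map_compose[OF snd_G h]] by auto
    then have "continuous_map ?Q (subtopology X (V e)) snd"
      "continuous_map ?Q (subtopology X (V e)) (h \<circ> snd)"
      using tQ cells[OF e] by (auto simp: continuous_map_in_subtopology Z_def)
    from this[THEN continuous_map_compose[OF _ continuous_\<kappa>[OF e]]]
    have "continuous_map ?Q euclidean (seg e)"
      unfolding seg_def o_def
      by (intro continuous_map_add continuous_map_scaleR continuous_map_diff fst') auto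
    then have "continuous_map ?Q (top_of_set (C e)) (seg e)"
      using seg_mem[OF e] tQ by (auto simp: continuous_map_in_subtopology)
    from continuous_map_compose[OF this continuous_q[OF e]]
    have "continuous_map ?Q X (\<lambda>p. q (seg e p))" by (simp add: o_def)
    moreover have "q (seg e p) \<in> \<Gamma> a" if "p \<in> Z e" for p
      using seg_mem[OF e that] V_subset[OF e] by (auto simp: \<Gamma>_def V_def)
    ultimately show "continuous_map ?Q ?G (\<lambda>p. q (seg e p))"
      using tQ by (auto simp: continuous_map_in_subtopology)
  next
    show "q (seg e p) = q (seg e' p)" if "e \<in> I" "e' \<in> I" "p \<in> topspace ?P \<inter> Z e \<inter> Z e'" for e e' p
      using seg_cong that by blast
    show "\<exists>e. e \<in> I \<and> p \<in> Z e \<and> H p = q (seg e p)" if "p \<in> topspace ?P" for p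
      using ex[OF that] H_eq by blast
  qed
  moreover have "H (0, w) = h w" "H (1, w) = id w" if "w \<in> topspace ?G" for w
  proof -
    have w: "w \<in> \<Gamma> a" using that by (simp add: topspace_\<Gamma>)
    then obtain e where e: "e \<in> I" "w \<in> V e" using ex_cell by blast
    have "(0, w) \<in> Z e" "(1, w) \<in> Z e" using e w by (auto simp: Z_def)
    then show "H (0, w) = h w" "H (1, w) = id w"
      using H_eq[OF e(1)] q_\<kappa>[OF e(2)] q_\<kappa>[OF cells[OF e w]] by (auto simp: seg_def)
  qed
  ultimately show ?thesis by (subst homotopic_with) auto
qed

lemma realise_mem_\<Gamma>: "\<alpha> \<in> NS a \<Longrightarrow> realise \<alpha> \<in> \<Gamma> a"
  using continuous_map_image_subset_topspace[OF continuous_realise, of a]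
  unfolding topspace_realisation topspace_\<Gamma> by blast

lemma homotopic_realise_classify:
  "homotopic_with (\<lambda>_. True) (subtopology X (\<Gamma> a)) (subtopology X (\<Gamma> a)) (realise \<circ> classify a) id"
proof (rule homotopic_id_if_cell_preserving)
  show "continuous_map (subtopology X (\<Gamma> a)) (subtopology X (\<Gamma> a)) (realise \<circ> classify a)"
    by (rule continuous_map_compose[OF continuous_classify continuous_realise])
  show "(realise \<circ> classify a) w \<in> V e" if "e \<in> I" "w \<in> V e" "w \<in> \<Gamma> a" for e w
    using realise_mem_V[OF classify_mem top_indices_classify] that by simp
qed

text \<open>\<open>classify a (realise \<alpha>)\<close> and \<open>\<alpha>\<close> need not lie in a common simplex, but each shares one with
  their normalised product: all top indices of \<open>\<alpha>\<close> belong to both supports.\<close>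

lemma homotopic_classify_realise:
  "homotopic_with (\<lambda>_. True) (realisation (N a)) (realisation (N a)) (classify a \<circ> realise) id"
proof -
  let ?R = "realisation (N a)"
  define g where "g = classify a \<circ> realise"
  define k where "k \<alpha> e = \<alpha> e * g \<alpha> e / (\<Sum>e\<in>I. \<alpha> e * g \<alpha> e)" for \<alpha> e
  have g: "continuous_map ?R ?R g"
    unfolding g_def by (rule continuous_map_compose[OF continuous_realise continuous_classify])
  have gNS: "g \<alpha> \<in> NS a" if "\<alpha> \<in> NS a" for \<alpha>
    using classify_mem[OF realise_mem_\<Gamma>[OF that]] by (simp add: g_def)
  have pos: "0 < (\<Sum>e\<in>I. \<alpha> e * g \<alpha> e)" if \<alpha>: "\<alpha> \<in> NS a" for \<alpha>
  proof -
    obtain e where e: "e \<in> top_indices \<alpha>" using top_indices_nonempty[OF \<alpha>] by blast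
    then have eI: "e \<in> I" by (simp add: top_indices_def)
    \<comment> \<open>\<open>realise\<close> takes the dual block of \<open>e\<close> into the cell
      \<open>e\<close>, and \<open>classify a\<close> takes that cell back into the block.\<close>
    have "e \<in> top_indices (g \<alpha>)"
      using top_indices_classify[OF realise_mem_V[OF \<alpha> e] eI realise_mem_\<Gamma>[OF \<alpha>]] by (simp add: g_def)
    then have "0 < \<alpha> e * g \<alpha> e"
      using top_indices_pos[OF \<alpha> e] top_indices_pos[OF gNS[OF \<alpha>]] by simp
    moreover have "0 \<le> \<alpha> e * g \<alpha> e" for e
      using \<alpha> gNS[OF \<alpha>] unfolding mem_NS by simp
    ultimately show ?thesis using finite_I eI by (intro sum_pos2[of _ e]) auto
  qed
  have "k \<alpha> \<in> NS a" if \<alpha>: "\<alpha> \<in> NS a" for \<alpha>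
    unfolding mem_NS
  proof (intro conjI allI)
    show "0 \<le> k \<alpha> e" for e
      using \<alpha> gNS[OF \<alpha>] pos[OF \<alpha>] unfolding mem_NS k_def by simp
    show sum1: "sum (k \<alpha>) I = 1" using pos[OF \<alpha>] by (simp add: k_def flip: sum_divide_distrib)
    then have "{e. k \<alpha> e \<noteq> 0} \<noteq> {}" by (auto intro: ccontr)
    moreover have "{e. k \<alpha> e \<noteq> 0} \<subseteq> {e. \<alpha> e \<noteq> 0}" by (auto simp: k_def)
    moreover have "{e. \<alpha> e \<noteq> 0} \<in> N a" using \<alpha> unfolding mem_NS by blast
    ultimately show "{e. k \<alpha> e \<noteq> 0} \<in> N a" using nerve_subset by blast
  qed
  moreover have "continuous_map ?R euclideanreal (\<lambda>\<alpha>. k \<alpha> e)" for e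
  proof -
    have "continuous_map ?R euclidean (\<lambda>\<alpha>. \<alpha>)" "continuous_map ?R euclidean g"
      using g continuous_map_into_fulltopology by (auto simp: realisation_N continuous_map_in_subtopology)
    then have "continuous_map ?R euclideanreal (\<lambda>\<alpha>. \<alpha> e)" "continuous_map ?R euclideanreal (\<lambda>\<alpha>. g \<alpha> e)" for e
      unfolding continuous_map_fun_iff by blast+
    then show ?thesis unfolding k_def using pos finite_I
      by (intro continuous_map_real_divide continuous_map_sum continuous_map_real_mult)
        (auto simp: topspace_realisation less_imp_neq[symmetric])
  qed
  ultimately have k: "continuous_map ?R ?R k"
    unfolding realisation_N continuous_map_in_subtopology continuous_map_fun_iff by auto
  \<comment> \<open>The support of \<open>k \<alpha>\<close> is contained in those of
    \<open>g \<alpha>\<close> and \<open>\<alpha>\<close>, so \<open>k\<close> is joined to both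
    maps by straight lines.\<close>
  have "homotopic_with (\<lambda>_. True) ?R ?R k g" "homotopic_with (\<lambda>_. True) ?R ?R k id"
    by (rule homotopic_nerve_maps[OF finite_I k]; use g in \<open>auto simp: k_def\<close>)+
  then show ?thesis
    unfolding g_def[symmetric] using homotopic_with_trans homotopic_with_symD by blast
qed

text \<open>Compatibility with the inclusions is immediate because \<open>realise\<close> has no
  level parameter. The inverse \<open>classify a\<close> depends on the level, but it only has to
  exist for each level separately.\<close>

theorem functorial_nerve:
  "functorial_homotopy_equivalence (\<lambda>a. realisation (N a)) (\<lambda>a. subtopology X (\<Gamma> a)) (\<lambda>_. realise)"
  unfolding functorial_homotopy_equivalence_def homotopy_equivalence_map_def
  using continuous_realise continuous_classify homotopic_realise_classify homotopic_classify_realise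
  by blast

end

section \<open>The cells of a polygon\<close>

text \<open>Sum and product embed the two-point subsets of \<open>\<complex>\<close> into \<open>\<complex> \<times> \<complex>\<close>.\<close>

definition sum_prod :: "complex set \<Rightarrow> complex \<times> complex" where
  "sum_prod w = (SOME p. \<exists>z1 z2. w = {z1, z2} \<and> p = (z1 + z2, z1 * z2))"

lemma sum_prod_eq: "sum_prod {z1, z2} = (z1 + z2, z1 * z2)"
  unfolding sum_prod_def
  by (rule some_equality) (auto simp: doubleton_eq_iff algebra_simps)

lemma continuous_sum_prod: "continuous_map (F2 (top_of_set S)) euclidean sum_prod"
proof (rule continuous_compose_quotient_map[OF quotient_map_F2])
  have pair: "continuous_map (prod_topology (top_of_set S) (top_of_set S)) (prod_topology euclidean euclidean)
      (\<lambda>p. (fst p, snd p))"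
    by (intro continuous_map_pairedI continuous_map_into_fulltopology[OF continuous_map_fst]
        continuous_map_into_fulltopology[OF continuous_map_snd])
  have "continuous_on UNIV (\<lambda>p::complex \<times> complex. (fst p + snd p, fst p * snd p))"
    by (intro continuous_intros)
  then have "continuous_map (prod_topology euclidean euclidean) euclidean
      (\<lambda>p::complex \<times> complex. (fst p + snd p, fst p * snd p))"
    unfolding prod_topology_euclidean continuous_map_iff_continuous2 .
  from continuous_map_compose[OF pair this]
  show "continuous_map (prod_topology (top_of_set S) (top_of_set S)) euclidean
      (sum_prod \<circ> (\<lambda>p. {fst p, snd p}))"
    unfolding o_def sum_prod_eq fst_conv snd_conv .
qed

text \<open>The two points are the roots of the monic quadratic whose coefficients are given by
  their sum and product; evaluating it at \<open>a\<close> gives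
  \<open>(a - c) * (a - d) = 0\<close>.\<close>

lemma inj_sum_prod: "inj_on sum_prod (F2_set S)"
proof (rule inj_onI)
  fix v w assume "v \<in> F2_set S" "w \<in> F2_set S" and eq: "sum_prod v = sum_prod w"
  then obtain a b c d where v: "v = {a, b}" and w: "w = {c, d}" by (auto simp: F2_set_eq)
  have s: "a + b = c + d" "a * b = c * d" using eq by (auto simp: v w sum_prod_eq)
  have "(a - c) * (a - d) = a * a - a * (c + d) + c * d" by (simp add: algebra_simps)
  also have "\<dots> = 0" unfolding s[symmetric] by (simp add: algebra_simps)
  finally have "a = c \<or> a = d" by simp
  then show "v = w" using s(1) by (auto simp: v w)
qed

locale embedded_polygon =
  fixes n :: nat and x :: "nat \<Rightarrow> 'b::euclidean_space"
  assumes n: "n > 4" and inj_x: "inj_on x {..<n}"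
    and embedding: "embedding_map (top_of_set (sphere 0 1)) euclidean (pl_interp n x)"
begin

abbreviation "\<gamma> \<equiv> pl_interp n x"
abbreviation "S1 \<equiv> sphere (0::complex) 1"

text \<open>The inverse of the embedding. Points of the polygon, rather than circle parameters,
  serve as coordinates, so that charts of different cells can differ only by the order of the two
  points.\<close>

definition \<delta> :: "'b \<Rightarrow> complex" where "\<delta> = inv_into S1 \<gamma>"

lemma n1: "n > 1" using n by simp

lemma continuous_\<gamma>: "continuous_map (top_of_set S1) euclidean \<gamma>"
  using embedding by (simp add: embedding_map_def homeomorphic_eq_everything_map continuous_map_in_subtopology)

lemma inj_\<gamma>: "inj_on \<gamma> S1"
  using embedding by (simp add: embedding_map_def homeomorphic_eq_everything_map)

lemma \<delta>_\<gamma>: "z \<in> S1 \<Longrightarrow> \<delta> (\<gamma> z) = z"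
  unfolding \<delta>_def using inj_\<gamma> by (rule inv_into_f_f)

lemma continuous_\<delta>: "continuous_on (\<gamma> ` S1) \<delta>"
  using continuous_\<gamma> \<delta>_\<gamma> by (intro continuous_on_inv) auto

section \<open>Edges of the polygon and their intersections\<close>

definition edge_arc :: "nat \<Rightarrow> complex set" where
  "edge_arc i = (\<lambda>t. cis (2 * pi * t)) ` {knot n x i..knot n x (Suc i)}"

definition edge :: "nat \<Rightarrow> 'b set" where
  "edge i = closed_segment (x i) (x (Suc i mod n))"

lemma edge_arc_subset: "edge_arc i \<subseteq> S1"
  by (auto simp: edge_arc_def)

lemma mem_edge_iff: "y \<in> edge i \<longleftrightarrow> (\<exists>s. 0 \<le> s \<and> s \<le> 1 \<and> y = x i + s *\<^sub>R edge_vec n x i)"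
  unfolding edge_def closed_segment_def edge_vec_def by (auto simp: algebra_simps)

lemma pl_piece_image:
  assumes "i < n"
  shows "pl_piece n x i ` {knot n x i..knot n x (Suc i)} = edge i"
proof -
  note l = edge_len_pos[OF n1 inj_x assms] and L = total_len_pos[OF n1 inj_x]
  let ?c = "total_len n x / edge_len n x i"
  have c: "?c > 0" using l L by simp
  show ?thesis
  proof (intro set_eqI iffI)
    fix y assume "y \<in> pl_piece n x i ` {knot n x i..knot n x (Suc i)}"
    then obtain t where t: "knot n x i \<le> t" "t \<le> knot n x i + edge_len n x i / total_len n x"
      and y: "y = pl_piece n x i t" by (auto simp: knot_Suc)
    have "0 \<le> ?c * (t - knot n x i)" using l L t by (intro mult_nonneg_nonneg) auto
    moreover have "?c * (t - knot n x i) \<le> 1" using l L t by (simp add: field_simps)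
    ultimately show "y \<in> edge i" unfolding mem_edge_iff y pl_piece_def
      by (intro exI[of _ "?c * (t - knot n x i)"]) simp
  next
    fix y assume "y \<in> edge i"
    then obtain s where s: "0 \<le> s" "s \<le> 1" "y = x i + s *\<^sub>R edge_vec n x i"
      unfolding mem_edge_iff by blast
    have "knot n x i + s / ?c \<in> {knot n x i..knot n x (Suc i)}"
      using s l L by (simp add: knot_Suc field_simps mult_left_le_one_le)
    moreover have "y = pl_piece n x i (knot n x i + s / ?c)"
      using s l L by (simp add: pl_piece_def)
    ultimately show "y \<in> pl_piece n x i ` {knot n x i..knot n x (Suc i)}" by blast
  qed
qed

lemma \<gamma>_arc: "i < n \<Longrightarrow> \<gamma> ` edge_arc i = edge i"
  using pl_piece_image[of i] pl_interp_cis[OF n1 inj_x, of i] by (force simp: edge_arc_def image_image)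

lemma \<delta>_edge: "i < n \<Longrightarrow> \<delta> ` edge i = edge_arc i"
  using \<gamma>_arc[of i] edge_arc_subset[of i] \<delta>_\<gamma> by (force simp: image_image)

lemma edge_subset: "i < n \<Longrightarrow> edge i \<subseteq> \<gamma> ` S1"
  using \<gamma>_arc[of i] edge_arc_subset[of i] by blast

lemma knot_mono: "i \<le> j \<Longrightarrow> j \<le> n \<Longrightarrow> knot n x i \<le> knot n x j"
  using knot_strict_mono[OF n1 inj_x, of i j] by (cases "i = j") auto

lemma knot_0: "knot n x 0 = 0" by (simp add: knot_def)

lemma ex_edge_arc:
  assumes "z \<in> S1"
  shows "\<exists>i<n. z \<in> edge_arc i"
proof -
  define t where "t = Arg2pi z / (2 * pi)"
  have "z = exp (\<i> * of_real (Arg2pi z))" using Arg2pi_eq[of z] assms by simp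
  then have z: "z = cis (2 * pi * t)" by (simp add: t_def cis_conv_exp)
  have t: "0 \<le> t" "t \<le> 1" using Arg2pi_ge_0[of z] Arg2pi_lt_2pi[of z] by (auto simp: t_def)
  \<comment> \<open>By induction, the first \<open>m\<close> parameter intervals cover everything
    from 0 to \<open>knot n x m\<close>; for \<open>m = n\<close> this reaches 1.\<close>
  have "m \<le> n \<Longrightarrow> 0 < m \<Longrightarrow> t \<le> knot n x m \<Longrightarrow> \<exists>i<m. t \<in> {knot n x i..knot n x (Suc i)}" for m
  proof (induction m)
    case (Suc m)
    show ?case
    proof (cases "m > 0 \<and> t \<le> knot n x m")
      case True
      then show ?thesis using Suc less_SucI by fastforce
    next
      case False
      then have "knot n x m \<le> t" using t knot_0 by auto
      then show ?thesis using Suc by auto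
    qed
  qed simp
  from this[of n] show ?thesis using z t n knot_n[OF n1 inj_x] by (auto simp: edge_arc_def)
qed

text \<open>Injectivity of \<open>\<gamma>\<close> forces the two parameters to differ by an
  integer, which is 0 or 1. The value 0 means a common knot of consecutive intervals; the value 1
  means the parameters 0 and 1, where the polygon closes up.\<close>

lemma edge_inter_less:
  assumes ij: "i < j" "j < n" and y: "y \<in> edge i" "y \<in> edge j"
  shows "(j = Suc i \<and> y = x j) \<or> (i = 0 \<and> Suc j = n \<and> y = x 0)"
proof -
  have "y \<in> \<gamma> ` edge_arc i" "y \<in> \<gamma> ` edge_arc j" using \<gamma>_arc y ij by auto
  then obtain t t' where t: "t \<in> {knot n x i..knot n x (Suc i)}" and yt: "y = \<gamma> (cis (2 * pi * t))"
    and t': "t' \<in> {knot n x j..knot n x (Suc j)}" and yt': "y = \<gamma> (cis (2 * pi * t'))"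
    by (auto simp: edge_arc_def)
  have "cis (2 * pi * t) = cis (2 * pi * t')"
    using inj_\<gamma> yt yt' by (auto dest: inj_onD)
  then have "sin (2 * pi * t') = sin (2 * pi * t) \<and> cos (2 * pi * t') = cos (2 * pi * t)"
    by (simp add: complex_eq_iff)
  then obtain m :: int where "2 * pi * t' = 2 * pi * t + 2 * pi * m"
    unfolding sin_cos_eq_iff by blast
  then have m: "t' = t + m" by (metis distrib_left mult_cancel_left pi_neq_zero mult_eq_0_iff zero_neq_numeral)
  have tt': "t \<le> t'" "0 \<le> t" "t' \<le> 1"
    using t t' knot_mono[of "Suc i" j] knot_mono[of 0 i] knot_mono[of "Suc j" n]
      knot_0 knot_n[OF n1 inj_x] ij by auto
  then have "m = 0 \<or> m = 1" using m by auto
  then show ?thesis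
  proof
    assume "m = 0"
    then have eq: "t = knot n x j" "knot n x (Suc i) = knot n x j"
      using m t t' knot_mono[of "Suc i" j] ij by auto
    then have "Suc i = j" using knot_strict_mono[OF n1 inj_x, of "Suc i" j] ij by (cases "Suc i = j") auto
    moreover have "y = x j" using yt' m \<open>m = 0\<close> eq pl_interp_cis[OF n1 inj_x ij(2) t'] pl_piece_knot[of n x j] by simp
    ultimately show ?thesis by simp
  next
    assume "m = 1"
    then have eq: "t = 0" "t' = 1" using m tt' by auto
    have "i = 0" using knot_strict_mono[OF n1 inj_x, of 0 i] eq t ij knot_0 by (cases "i = 0") auto
    moreover have "Suc j = n"
      using knot_strict_mono[OF n1 inj_x, of "Suc j" n] eq t' ij knot_n[OF n1 inj_x] by (cases "Suc j = n") auto
    moreover have "y = x 0"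
      using yt eq pl_interp_cis[OF n1 inj_x, of 0 0] pl_piece_knot[of n x 0] knot_0 t \<open>i = 0\<close> n by simp
    ultimately show ?thesis by simp
  qed
qed

lemma edge_inter:
  assumes "i \<noteq> j" "i < n" "j < n" "y \<in> edge i" "y \<in> edge j"
  shows "(j = Suc i mod n \<and> y = x j) \<or> (i = Suc j mod n \<and> y = x i)"
proof (cases "i < j")
  case True
  then show ?thesis using edge_inter_less[OF True assms(3-5)] assms by auto
next
  case False
  then have "j < i" using assms(1) by simp
  then show ?thesis using edge_inter_less[OF _ assms(2,5,4)] assms by auto
qed

lemma Suc_mod: "i < n \<Longrightarrow> Suc i mod n = (if Suc i = n then 0 else Suc i)"
  by auto

text \<open>Two distinct edges can follow each other in only one direction, since the cycle is
  longer than 2, so they share at most one vertex.\<close>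

lemma edge_inter_unique:
  assumes "i \<noteq> j" "i < n" "j < n" "y \<in> edge i" "y \<in> edge j" "z \<in> edge i" "z \<in> edge j"
  shows "y = z"
  using edge_inter[OF assms(1-5)] edge_inter[OF assms(1-3,6,7)] n assms(1-3)
  by (auto simp: Suc_mod split: if_splits)

section \<open>Charts of the cells and their transitions\<close>

text \<open>A linear functional that orders the points of edge \<open>i\<close> from its first to
  its second end.\<close>

definition height :: "nat \<Rightarrow> 'b \<Rightarrow> real" where
  "height i y = edge_vec n x i \<bullet> y"

lemma height_edge:
  assumes "i < n"
  shows "y \<in> edge i \<Longrightarrow> z \<in> edge i \<Longrightarrow> height i y = height i z \<Longrightarrow> y = z"
    and "y \<in> edge i \<Longrightarrow> height i (x i) \<le> height i y"
    and "y \<in> edge i \<Longrightarrow> height i y \<le> height i (x (Suc i mod n))"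
    and "x i \<in> edge i" "x (Suc i mod n) \<in> edge i"
proof -
  let ?u = "edge_vec n x i"
  have u: "?u \<bullet> ?u > 0" using edge_len_pos[OF n1 inj_x assms] by (auto simp: edge_len_def)
  have h: "height i (x i + s *\<^sub>R ?u) = height i (x i) + s * (?u \<bullet> ?u)" for s
    by (simp add: height_def inner_add_right)
  have x': "x (Suc i mod n) = x i + 1 *\<^sub>R ?u" by (simp add: edge_vec_def)
  show "y \<in> edge i \<Longrightarrow> z \<in> edge i \<Longrightarrow> height i y = height i z \<Longrightarrow> y = z"
    using u by (auto simp: mem_edge_iff h)
  show "y \<in> edge i \<Longrightarrow> height i (x i) \<le> height i y"
    using u by (auto simp: mem_edge_iff h)
  show "y \<in> edge i \<Longrightarrow> height i y \<le> height i (x (Suc i mod n))"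
    using u unfolding x' h mem_edge_iff by (auto simp: h mult_left_le_one_le)
  show "x i \<in> edge i" "x (Suc i mod n) \<in> edge i" by (auto simp: edge_def)
qed

text \<open>\<open>Min\<close> and \<open>Max\<close> order the unordered index pair. A diagonal
  cell needs only half of the square, because \<open>(a, b)\<close> and \<open>(b, a)\<close> give
  the same subset; the height condition selects a triangle.\<close>

definition cell_chart :: "nat set \<Rightarrow> ('b \<times> 'b) set" where
  "cell_chart e = {p. fst p \<in> edge (Min e) \<and> snd p \<in> edge (Max e) \<and>
     (Min e = Max e \<longrightarrow> height (Min e) (fst p) \<le> height (Min e) (snd p))}"

definition pair :: "'b \<times> 'b \<Rightarrow> complex set" where
  "pair p = {\<delta> (fst p), \<delta> (snd p)}"

lemma cell_chart_le:
  "i \<le> j \<Longrightarrow> cell_chart {i, j} = {p. fst p \<in> edge i \<and> snd p \<in> edge j \<and>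
     (i = j \<longrightarrow> height i (fst p) \<le> height i (snd p))}"
  by (auto simp: cell_chart_def min_def max_def)

lemma cell_index_cases:
  assumes "e \<in> cell_index n"
  obtains i j where "e = {i, j}" "i \<le> j" "j < n"
  using assms unfolding cell_index_def by (auto, metis insert_commute nle_le)

lemma cell_chart_subset:
  assumes "e \<in> cell_index n"
  shows "cell_chart e \<subseteq> \<gamma> ` S1 \<times> \<gamma> ` S1"
proof
  fix p assume p: "p \<in> cell_chart e"
  obtain i j where e: "e = {i, j}" "i \<le> j" "j < n" using cell_index_cases[OF assms] by blast
  then have "fst p \<in> edge i" "snd p \<in> edge j" using p by (auto simp: cell_chart_le)
  then have "fst p \<in> \<gamma> ` S1" "snd p \<in> \<gamma> ` S1"
    using edge_subset[of i] edge_subset[of j] e by auto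
  then show "p \<in> \<gamma> ` S1 \<times> \<gamma> ` S1" unfolding mem_Times_iff by blast
qed

lemma pair_swap: "pair (prod.swap p) = pair p"
  by (auto simp: pair_def)

lemma pair_eq:
  assumes "p \<in> \<gamma> ` S1 \<times> \<gamma> ` S1" "p' \<in> \<gamma> ` S1 \<times> \<gamma> ` S1" "pair p = pair p'"
  shows "p' = p \<or> p' = prod.swap p"
proof -
  have inj: "inj_on \<delta> (\<gamma> ` S1)" by (rule inj_on_inverseI[of _ \<gamma>]) (auto simp: \<delta>_\<gamma>)
  show ?thesis
    using assms(3) inj_onD[OF inj, of "fst p"] inj_onD[OF inj, of "snd p"] assms(1,2)
    unfolding pair_def doubleton_eq_iff mem_Times_iff prod_eq_iff fst_swap snd_swap by metis
qed

lemma pair_cell_chart: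
  assumes "e \<in> cell_index n"
  shows "pair ` cell_chart e = cell n x e"
proof -
  obtain i j where e: "e = {i, j}" "i \<le> j" "j < n" using cell_index_cases[OF assms] by blast
  have cell: "cell n x e = {{z1, z2} | z1 z2. z1 \<in> edge_arc i \<and> z2 \<in> edge_arc j}"
    unfolding e(1) cell_eq edge_arc_def by blast
  show ?thesis
  proof (intro set_eqI iffI)
    fix w assume "w \<in> pair ` cell_chart e"
    then obtain p where w: "w = pair p" and "fst p \<in> edge i" "snd p \<in> edge j"
      using e by (auto simp: cell_chart_le)
    then have "\<delta> (fst p) \<in> edge_arc i" "\<delta> (snd p) \<in> edge_arc j"
      using \<delta>_edge[of i] \<delta>_edge[of j] e by auto
    then show "w \<in> cell n x e" unfolding cell w pair_def by blast
  next
    fix w assume "w \<in> cell n x e"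
    then obtain z1 z2 where z: "w = {z1, z2}" "z1 \<in> edge_arc i" "z2 \<in> edge_arc j" unfolding cell by blast
    let ?p = "(\<gamma> z1, \<gamma> z2)"
    have "z1 \<in> S1" "z2 \<in> S1" using z edge_arc_subset by blast+
    then have w: "w = pair ?p" using z(1) by (simp add: pair_def \<delta>_\<gamma>)
    have "\<gamma> z1 \<in> edge i" "\<gamma> z2 \<in> edge j" using z e \<gamma>_arc[of i] \<gamma>_arc[of j] by auto
    \<comment> \<open>For a diagonal cell one of the two orders satisfies the height condition;
      otherwise \<open>?p\<close> itself fits.\<close>
    then have "?p \<in> cell_chart e \<or> prod.swap ?p \<in> cell_chart e"
      using e by (auto simp: cell_chart_le)
    then show "w \<in> pair ` cell_chart e" using w pair_swap[of ?p] by (metis image_eqI)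
  qed
qed

text \<open>Two distinct edges that meet a given edge do so in a fixed order along it.  Hence the
  transition between a diagonal cell and any other cell is the identity throughout or the swap
  throughout, except at diagonal points, where both agree.\<close>

lemma diagonal_transition:
  assumes ikl: "i < n" "k < n" "l < n" "k \<noteq> l"
    and a: "a \<in> edge i" "a \<in> edge k" and b: "b \<in> edge i" "b \<in> edge l"
    and c: "c \<in> edge i" "c \<in> edge l" and d: "d \<in> edge i" "d \<in> edge k"
    and h: "height i a \<le> height i b" "height i c \<le> height i d"
  shows "a = b \<or> c = d"
proof -
  have ad: "a = d" if "k \<noteq> i" using that edge_inter_unique[of i k a d] ikl a d by auto
  have bc: "b = c" if "l \<noteq> i" using that edge_inter_unique[of i l b c] ikl b c by auto
  have ends: "y = x i \<or> y = x (Suc i mod n)" if "y \<in> edge i" "y \<in> edge j" "j \<noteq> i" "j < n" for y j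
    using edge_inter[of i j y] that ikl by auto
  have eqI: "y = z" if "y \<in> edge i" "z \<in> edge i" "height i y \<le> height i z" "height i z \<le> height i y" for y z
    using height_edge(1)[OF ikl(1), of y z] that by linarith
  consider "k \<noteq> i" "l \<noteq> i" | "k = i" "l \<noteq> i" | "k \<noteq> i" "l = i" using ikl(4) by blast
  then show ?thesis
  proof cases
    case 1
    \<comment> \<open>Here \<open>a = d\<close> and \<open>b = c\<close>, so the two height
      inequalities are opposite.\<close>
    then have "a = b" using eqI[of a b] ad bc a b h by simp
    then show ?thesis ..
  next
    case 2
    \<comment> \<open>The point \<open>b = c\<close> is an end of edge \<open>i\<close>. If it is
      the lower end, then \<open>a = b\<close>; if it is the upper end, then
      \<open>c = d\<close>.\<close>
    from ends[OF b this(2) ikl(3)] have "b = x i \<or> b = x (Suc i mod n)" .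
    then show ?thesis
      using eqI[of a b] eqI[of c d] bc[OF 2(2)] a b c d h height_edge(2,3)[OF ikl(1)] by metis
  next
    case 3
    from ends[OF a this(1) ikl(2)] have "a = x i \<or> a = x (Suc i mod n)" .
    then show ?thesis
      using eqI[of a b] eqI[of c d] ad[OF 3(1)] a b c d h height_edge(2,3)[OF ikl(1)] by metis
  qed
qed

text \<open>A cycle of length at least \<open>5\<close> contains no 4-cycle.  For \<open>n = 4\<close> this fails with
  \<open>{0, 2}\<close> and \<open>{1, 3}\<close>.\<close>

lemma adjacency:
  assumes "i < j" "j < n" "k < l" "l < n" "(i, j) \<noteq> (k, l)"
    and "\<And>p q. p \<in> {i, j} \<Longrightarrow> q \<in> {k, l} \<Longrightarrow> p = q \<or> q = Suc p mod n \<or> p = Suc q mod n"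
  shows False
proof -
  have "p = q \<or> q = Suc p \<or> p = Suc q \<or> (p = 0 \<and> Suc q = n) \<or> (q = 0 \<and> Suc p = n)"
    if "p \<in> {i, j}" "q \<in> {k, l}" for p q
    using assms(6)[OF that] that assms(1-4) by (auto simp: Suc_mod split: if_splits)
  \<comment> \<open>These four instances form a 4-cycle if the index pairs are disjoint, and a
    triangle if they share one index.\<close>
  from this[of i k] this[of i l] this[of j k] this[of j l] show False
    using assms(1-5) n by auto
qed

text \<open>This excludes a transition that is the identity at one non-diagonal point and the swap
  at another. Two distinct off-diagonal cells cannot meet in both ways by \<open>adjacency\<close>;
  the other cases follow from the height order or from the uniqueness of common points of
  edges.\<close>

lemma chart_transition:
  assumes e: "e \<in> cell_index n" and e': "e' \<in> cell_index n"
    and p: "p \<in> cell_chart e" "p \<in> cell_chart e'"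
    and r: "r \<in> cell_chart e" "prod.swap r \<in> cell_chart e'"
  shows "fst p = snd p \<or> fst r = snd r"
proof -
  obtain i j where ij: "e = {i, j}" "i \<le> j" "j < n" using cell_index_cases[OF e] by blast
  obtain k l where kl: "e' = {k, l}" "k \<le> l" "l < n" using cell_index_cases[OF e'] by blast
  obtain a b c d where ab: "p = (a, b)" and cd: "r = (c, d)" by (cases p; cases r)
  have a: "a \<in> edge i" "a \<in> edge k" and b: "b \<in> edge j" "b \<in> edge l"
    and c: "c \<in> edge i" "c \<in> edge l" and d: "d \<in> edge j" "d \<in> edge k"
    and hi: "i = j \<Longrightarrow> height i a \<le> height i b" "i = j \<Longrightarrow> height i c \<le> height i d"
    and hk: "k = l \<Longrightarrow> height k a \<le> height k b" "k = l \<Longrightarrow> height k d \<le> height k c"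
    using p r unfolding ij(1) kl(1) cell_chart_le[OF ij(2)] cell_chart_le[OF kl(2)] ab cd by auto
  have "a = b \<or> c = d"
  proof (cases "i = j")
    case i: True
    show ?thesis
    proof (cases "k = l")
      case True
      show ?thesis
      proof (cases "i = k")
        case True
        then show ?thesis using height_edge(1)[of i c d] hi hk i \<open>k = l\<close> ij kl c d by force
      next
        case False
        then show ?thesis using edge_inter_unique[of i k a b] i \<open>k = l\<close> ij kl a b by auto
      qed
    next
      case False
      then show ?thesis using diagonal_transition[of i k l a b c d] i hi ij kl a b c d by auto
    qed
  next
    case i: False
    show ?thesis
    proof (cases "k = l")
      case True
      then show ?thesis using diagonal_transition[of k i j a b d c] i hk ij kl a b c d by auto
    next
      case k: False
      show ?thesis
      proof (cases "(i, j) = (k, l)")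
        case True
        then show ?thesis using edge_inter_unique[of i j c d] i ij c d by auto
      next
        case False
        \<comment> \<open>The points \<open>a\<close>, \<open>c\<close>, \<open>d\<close>,
          \<open>b\<close> witness that each of the edges \<open>i\<close>, \<open>j\<close> meets
          each of \<open>k\<close>, \<open>l\<close>.\<close>
        have "u = v \<or> v = Suc u mod n \<or> u = Suc v mod n" if "u \<in> {i, j}" "v \<in> {k, l}" for u v
          using that edge_inter[of u v] a b c d ij kl by fastforce
        then show ?thesis using adjacency[of i j k l] False i k ij kl by fastforce
      qed
    qed
  qed
  then show ?thesis using ab cd by simp
qed

lemma linear_swap: "linear (prod.swap :: 'b \<times> 'b \<Rightarrow> 'b \<times> 'b)"
  by (rule linearI) auto

text \<open>If the charts share a non-diagonal point, the identity works throughout; otherwise the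
  swap does, since it fixes the diagonal points.\<close>

lemma chart_transition_linear:
  assumes e: "e \<in> cell_index n" and e': "e' \<in> cell_index n"
  shows "\<exists>L. linear L \<and> (\<forall>c. pair (L c) = pair c) \<and>
      (\<forall>c\<in>cell_chart e. \<forall>c'\<in>cell_chart e'. pair c = pair c' \<longrightarrow> c' = L c)"
proof -
  have cases: "c' = c \<or> c' = prod.swap c" 
    if "c \<in> cell_chart e" "c' \<in> cell_chart e'" "pair c = pair c'" for c c'
    using pair_eq that cell_chart_subset[OF e] cell_chart_subset[OF e'] by blast
  show ?thesis
  proof (cases "\<exists>p. p \<in> cell_chart e \<and> p \<in> cell_chart e' \<and> fst p \<noteq> snd p")
    case True
    then have *: "fst r = snd r" if "r \<in> cell_chart e" "prod.swap r \<in> cell_chart e'" for r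
      using chart_transition[OF e e'] that by blast
    have "c' = c" if "c \<in> cell_chart e" "c' \<in> cell_chart e'" "pair c = pair c'" for c c'
      using cases[OF that] *[of c] that by (cases c) auto
    then show ?thesis by (intro exI[of _ id]) (auto simp: linear_id)
  next
    case False
    have "c' = prod.swap c" if "c \<in> cell_chart e" "c' \<in> cell_chart e'" "pair c = pair c'" for c c'
      using cases[OF that] False that by (cases c) auto
    then show ?thesis by (intro exI[of _ prod.swap]) (auto simp: linear_swap pair_swap)
  qed
qed

text \<open>Compare the chart with itself: if it contains both a point and its swap, then
  \<open>chart_transition\<close> makes the point diagonal, so the two coincide.\<close>

lemma inj_pair: 
  assumes "e \<in> cell_index n"
  shows "inj_on pair (cell_chart e)"
proof (rule inj_onI)
  fix p p' assume p: "p \<in> cell_chart e" "p' \<in> cell_chart e" "pair p = pair p'"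
  then have "p' = p \<or> p' = prod.swap p" using pair_eq cell_chart_subset[OF assms] by blast
  moreover have "p = p'" if "p' = prod.swap p"
  proof -
    have "p' = prod.swap p' \<or> p = prod.swap p"
      using chart_transition[OF assms assms p(1,1,1)] chart_transition[OF assms assms p(1,1) p(1)] p that
      by (cases p) auto
    then show ?thesis using that by auto
  qed
  ultimately show "p = p'" by blast
qed

section \<open>Convexity and continuity in the charts\<close>

lemma cell_chart_eq:
  "cell_chart e = edge (Min e) \<times> edge (Max e) \<inter>
    (if Min e = Max e then {p. (edge_vec n x (Min e), - edge_vec n x (Min e)) \<bullet> p \<le> 0} else UNIV)"
  by (auto simp: cell_chart_def height_def inner_Pair)

lemma compact_cell_chart: "e \<in> cell_index n \<Longrightarrow> compact (cell_chart e)"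
  unfolding cell_chart_eq edge_def
  by (intro compact_Int_closed compact_Times compact_segment) (auto simp: closed_halfspace_le)

lemma convex_cell_chart: "e \<in> cell_index n \<Longrightarrow> convex (cell_chart e)"
  unfolding cell_chart_eq edge_def
  by (intro convex_Int convex_Times convex_closed_segment) (auto simp: convex_halfspace_le)

lemma cell_chart_nonempty:
  assumes "e \<in> cell_index n"
  shows "cell_chart e \<noteq> {}"
proof -
  obtain i j where "e = {i, j}" "i \<le> j" "j < n" using cell_index_cases[OF assms] by blast
  then have "(x i, x j) \<in> cell_chart e" by (auto simp: cell_chart_le edge_def)
  then show ?thesis by blast
qed

lemma T_fun_pair:
  assumes "p \<in> \<gamma> ` S1 \<times> \<gamma> ` S1"
  shows "T_fun \<gamma> (pair p) = (norm (fst p - snd p))\<^sup>2 / 2"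
  using assms \<delta>_\<gamma> by (auto simp: pair_def T_fun_eq)

lemma convex_dist_sublevel: "convex {p :: 'b \<times> 'b. (norm (fst p - snd p))\<^sup>2 / 2 \<le> a}"
proof -
  \<comment> \<open>This covers negative \<open>a\<close> too: \<open>sqrt\<close> is odd, so the
    radius is negative and the ball empty.\<close>
  have "(norm v)\<^sup>2 / 2 \<le> a \<longleftrightarrow> norm v \<le> sqrt (2 * a)" for v :: 'b
  proof -
    have "(norm v)\<^sup>2 / 2 \<le> a \<longleftrightarrow> sqrt ((norm v)\<^sup>2) \<le> sqrt (2 * a)"
      unfolding real_sqrt_le_iff by auto
    then show ?thesis by simp
  qed
  then have "{p :: 'b \<times> 'b. (norm (fst p - snd p))\<^sup>2 / 2 \<le> a} = (\<lambda>p. fst p - snd p) -` cball 0 (sqrt (2 * a))"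
    by (intro set_eqI) simp
  moreover have "linear (\<lambda>p :: 'b \<times> 'b. fst p - snd p)" by (rule linearI) (auto simp: algebra_simps)
  ultimately show ?thesis using convex_linear_vimage by fastforce
qed

lemma convex_chart_sublevel:
  assumes "e \<in> cell_index n"
  shows "convex {p \<in> cell_chart e. T_fun \<gamma> (pair p) \<le> a}"
proof -
  have eq: "T_fun \<gamma> (pair p) = (norm (fst p - snd p))\<^sup>2 / 2" if "p \<in> cell_chart e" for p
    using T_fun_pair cell_chart_subset[OF assms] that by blast
  have "{p \<in> cell_chart e. T_fun \<gamma> (pair p) \<le> a} =
      cell_chart e \<inter> {p. (norm (fst p - snd p))\<^sup>2 / 2 \<le> a}"
    by (intro set_eqI) (simp only: Int_iff mem_Collect_eq eq cong: conj_cong)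
  then show ?thesis using convex_cell_chart[OF assms] convex_dist_sublevel by (simp add: convex_Int)
qed

lemma continuous_pair:
  assumes "e \<in> cell_index n"
  shows "continuous_map (top_of_set (cell_chart e)) (F2 (top_of_set S1)) pair"
proof -
  have "continuous_on (cell_chart e) (\<lambda>p. \<delta> (fst p))" "continuous_on (cell_chart e) (\<lambda>p. \<delta> (snd p))"
    using cell_chart_subset[OF assms]
    by (auto intro!: continuous_on_compose2[OF continuous_\<delta>] continuous_intros)
  moreover have "\<delta> ` \<gamma> ` S1 \<subseteq> S1" using \<delta>_\<gamma> by auto
  ultimately have "continuous_map (top_of_set (cell_chart e))
      (prod_topology (top_of_set S1) (top_of_set S1)) (\<lambda>p. (\<delta> (fst p), \<delta> (snd p)))"
    using cell_chart_subset[OF assms]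
    by (intro continuous_map_pairedI) (force simp: continuous_map_in_subtopology)+
  from continuous_map_compose[OF this quotient_imp_continuous_map[OF quotient_map_F2]]
  show ?thesis by (simp add: pair_def[abs_def] o_def)
qed

lemma continuous_T_fun: "continuous_map (F2 (top_of_set S1)) euclideanreal (T_fun \<gamma>)"
proof (rule continuous_compose_quotient_map[OF quotient_map_F2])
  have "continuous_map (prod_topology (top_of_set S1) (top_of_set S1)) euclidean (\<lambda>p. \<gamma> (fst p))"
    "continuous_map (prod_topology (top_of_set S1) (top_of_set S1)) euclidean (\<lambda>p. \<gamma> (snd p))"
    by (fact continuous_map_compose[OF continuous_map_fst continuous_\<gamma>, unfolded o_def]
        continuous_map_compose[OF continuous_map_snd continuous_\<gamma>, unfolded o_def])+
  then show "continuous_map (prod_topology (top_of_set S1) (top_of_set S1)) euclideanreal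
      (T_fun \<gamma> \<circ> (\<lambda>p. {fst p, snd p}))"
    unfolding o_def T_fun_eq
    by (intro continuous_map_real_divide continuous_map_real_pow continuous_map_norm continuous_map_diff) auto
qed

end

theorem proposition5p6:
  fixes n :: nat and x :: "nat \<Rightarrow> real ^ 'd"
  assumes "n > 4"
    and "inj_on x {..<n}"
    and "embedding_map (top_of_set (sphere 0 1)) euclidean (pl_interp n x)"
  shows "\<exists>f. functorial_homotopy_equivalence (nerve_space n x) (sublevel_space (pl_interp n x)) f"
proof -
  interpret embedded_polygon n x by unfold_locales (fact assms)+
  have "F2_set S1 = (\<Union>e\<in>cell_index n. pair ` cell_chart e)"
  proof (intro set_eqI iffI)
    fix w assume "w \<in> F2_set S1"
    then obtain z1 z2 where w: "w = {z1, z2}" "z1 \<in> S1" "z2 \<in> S1" by (auto simp: F2_set_eq)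
    obtain i j where ij: "i < n" "j < n" "z1 \<in> edge_arc i" "z2 \<in> edge_arc j" using ex_edge_arc w by blast
    then have "w \<in> cell n x {i, j}" unfolding cell_eq edge_arc_def w(1) by blast
    moreover have "{i, j} \<in> cell_index n" using ij by (auto simp: cell_index_def)
    ultimately show "w \<in> (\<Union>e\<in>cell_index n. pair ` cell_chart e)" using pair_cell_chart by blast
  next
    fix w assume "w \<in> (\<Union>e\<in>cell_index n. pair ` cell_chart e)"
    then obtain p where "p \<in> \<gamma> ` S1 \<times> \<gamma> ` S1" "w = pair p" using cell_chart_subset by blast
    then show "w \<in> F2_set S1" using \<delta>_\<gamma>
      by (auto simp: F2_set_eq pair_def intro!: image_eqI[of _ _ "(\<delta> (fst p), \<delta> (snd p))"])
  qed
  then have cover: "topspace (F2 (top_of_set S1)) = (\<Union>e\<in>cell_index n. pair ` cell_chart e)"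
    by (simp add: topspace_F2)
  have finite: "finite (cell_index n)"
    by (rule finite_subset[of _ "Pow {..<n}"]) (auto simp: cell_index_def)
  have inj: "inj_on sum_prod (topspace (F2 (top_of_set S1)))"
    unfolding topspace_F2 by (rule inj_sum_prod)
  interpret convex_cell_cover "F2 (top_of_set S1)" "cell_index n" cell_chart pair "T_fun \<gamma>" sum_prod
    by unfold_locales
      (fact finite compact_cell_chart cell_chart_nonempty continuous_pair inj_pair chart_transition_linear
        cover continuous_T_fun convex_chart_sublevel continuous_sum_prod inj)+
  have \<Gamma>: "\<Gamma> a = sublevel \<gamma> a" for a by (simp add: \<Gamma>_def sublevel_def topspace_F2)
  have "nerve (cell_index n) (sublevel_cell n x a) = N a" for a
    \<comment> \<open>The two families of cells are compared only on \<open>cell_index n\<close>,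
      which is all that the nerve sees.\<close>
    by (rule nerve_cong) (simp add: sublevel_cell_def V_def \<Gamma> pair_cell_chart)
  then have "nerve_space n x = (\<lambda>a. realisation (N a))"
    by (simp add: nerve_space_def fun_eq_iff)
  moreover have "sublevel_space \<gamma> = (\<lambda>a. subtopology (F2 (top_of_set S1)) (\<Gamma> a))"
    by (simp add: sublevel_space_def \<Gamma> fun_eq_iff)
  ultimately have "functorial_homotopy_equivalence (nerve_space n x) (sublevel_space \<gamma>) (\<lambda>_. realise)"
    using functorial_nerve by simp
  then show ?thesis by blast
qed

end
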